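(* Let $\beta\in(0,2]$ and let $B\in L^\infty(S^m)$ be nonnegative. If $\mathcal{L}_K$ is a positive integral operator on $L^2(S^m)$ generated by a kernel $K$ satisfying the averaged Hölder condition $$|M_t(K(y,\cdot))(x)-K(y,x)|\le B(y)t^\beta,\quad x,y\in S^m,\ t\in(0,\pi),$$ then $$a_n(\mathcal{L}_K)=O(n^{-\beta/m})\quad(n\to\infty).$$ Further, if the range of $\mathcal{L}_K^{1/2}$ is entirely composed of continuous functions, then $$a_n(\mathcal{L}_K)=O(n^{-1-\beta/m})\quad(n\to\infty).$$
   Context: Fix a positive integer $m$. $S^m$ is the unit sphere of $\mathbb{R}^{m+1}$, $\sigma_m$ its surface measure, $L^p(S^m)=L^p(S^m,\sigma_m)$ (complex-valued functions). Average operator: for $t\in(0,\pi)$ and $x\in S^m$ let $C_t^x=\{y\in S^m: x\cdot y\ge\cos t\}$, let $C_m(t)=\sigma_m(C_t^x)$ (independent of $x$), and $M_t(f)(x)=\frac1{C_m(t)}\int_{C_t^x}f(w)\,d\sigma_m(w)$. Positive integral operators: for $K\in L^2(S^m\times S^m)$, $\mathcal{L}_K(f)(x)=\int_{S^m}K(x,y)f(y)\,d\sigma_m(y)$ on $L^2(S^m)$. It is called a positive integral operator if: $\int_{S^m}\mathcal{L}_K(f)(x)\overline{f(x)}\,d\sigma_m(x)\ge0$ for all $f\in L^2(S^m)$; the square root $\mathcal{L}_K^{1/2}$ is an integral operator on $L^2(S^m)$ generated by a hermitian kernel $K_{1/2}:S^m\times S^m\to\mathbb{C}$; and $\int_{S^m}K_{1/2}(x,y)K_{1/2}(w,x)\,d\sigma_m(x)=K(w,y)$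 for $y,w\in S^m$. $a_n(T)=\min\{\|T-U\|:\operatorname{rank}U\le n-1\}$ (bounded linear $U$ on $L^2(S^m)$, operator norm) is the $n$-th approximation number of a compact operator $T$ on $L^2(S^m)$; $a_n(\mathcal{L}_K)$ equals the $n$-th eigenvalue of $\mathcal{L}_K$ in decreasing order with multiplicities. *)

theory Defs
  imports "HOL-Analysis.Analysis" "HOL-Library.Landau_Symbols"
begin

section \<open>Surface measure on the unit sphere\<close>

text \<open>
  The unit sphere of an \<open>(m+1)\<close>-dimensional Euclidean space is \<^term>\<open>sphere 0 1\<close>.
  Its surface measure is obtained from Lebesgue measure by polar coordinates:
  the measure of a Borel set \<open>A\<close> is \<open>m + 1\<close> times the volume of the cone
  \<open>{r x | 0 < r \<le> 1, x \<in> A}\<close>.  Note that \<open>sgn x = x / norm x\<close>.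
\<close>

definition sphere_measure :: "'a::euclidean_space measure" where
  "sphere_measure =
     scale_measure (of_nat DIM('a))
       (distr (restrict_space lborel (cball 0 1 - {0})) (restrict_space borel (sphere 0 1)) sgn)"

lemma space_sphere_measure [simp]: "space sphere_measure = sphere 0 1"
  by (simp add: sphere_measure_def space_scale_measure space_restrict_space)

lemma sets_sphere_measure [measurable_cong]:
  "sets sphere_measure = sets (restrict_space borel (sphere 0 1))"
  by (simp add: sphere_measure_def)

lemma measurable_sgn_sphere:
  "sgn \<in> restrict_space lborel (cball 0 1 - {0::'a::euclidean_space})
           \<rightarrow>\<^sub>M restrict_space borel (sphere 0 1)"
proof (rule measurable_restrict_space2)
  show "sgn \<in> space (restrict_space lborel (cball 0 1 - {0::'a})) \<rightarrow> sphere 0 1"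
    by (auto simp: space_restrict_space norm_sgn)
  have "(\<lambda>x::'a. x /\<^sub>R norm x) \<in> borel_measurable lborel"
    by measurable
  then show "sgn \<in> borel_measurable (restrict_space lborel (cball 0 1 - {0::'a}))"
    unfolding sgn_div_norm [abs_def] by (rule measurable_restrict_space1)
qed

lemma emeasure_sphere_measure:
  fixes A :: "'a::euclidean_space set"
  assumes "A \<in> sets (restrict_space borel (sphere 0 1))"
  shows "emeasure sphere_measure A =
           of_nat DIM('a) * emeasure lborel {r *\<^sub>R x | r x. 0 < r \<and> r \<le> 1 \<and> x \<in> A}"
proof -
  have sub: "A \<subseteq> sphere 0 1"
    using sets.sets_into_space [OF assms] by (simp add: space_restrict_space)
  have eq: "sgn -` A \<inter> space (restrict_space lborel (cball 0 1 - {0::'a})) =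
             {r *\<^sub>R x | r x. 0 < r \<and> r \<le> 1 \<and> x \<in> A}" (is "?L = ?R")
  proof
    show "?L \<subseteq> ?R"
    proof
      fix y assume y: "y \<in> ?L"
      then have "y = norm y *\<^sub>R sgn y" "0 < norm y" "norm y \<le> 1" "sgn y \<in> A"
        by (auto simp: space_restrict_space sgn_div_norm)
      then show "y \<in> ?R" by blast
    qed
    show "?R \<subseteq> ?L"
    proof
      fix y assume "y \<in> ?R"
      then obtain r x where rx: "y = r *\<^sub>R x" "0 < r" "r \<le> 1" "x \<in> A" by blast
      with sub have nx: "norm x = 1" by auto
      with rx have "sgn y = x" by (simp add: sgn_div_norm)
      with rx nx show "y \<in> ?L" by (auto simp: space_restrict_space)
    qed
  qed
  have "emeasure (distr (restrict_space lborel (cball 0 1 - {0::'a}))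
                   (restrict_space borel (sphere 0 1)) sgn) A =
          emeasure lborel {r *\<^sub>R x | r x. 0 < r \<and> r \<le> 1 \<and> x \<in> A}"
    unfolding emeasure_distr [OF measurable_sgn_sphere assms] eq
    by (rule emeasure_restrict_space) (auto simp flip: eq simp: space_restrict_space)
  then show ?thesis
    by (simp add: sphere_measure_def)
qed

lemma finite_measure_sphere_measure: "finite_measure (sphere_measure :: 'a::euclidean_space measure)"
proof
  let ?C = "{r *\<^sub>R x | r x. 0 < r \<and> r \<le> 1 \<and> x \<in> sphere (0::'a) 1}"
  have "emeasure lborel ?C \<le> emeasure lborel (cball (0::'a) 1)"
    by (rule emeasure_mono) auto
  also have "\<dots> < \<infinity>"
    by (rule emeasure_lborel_cball_finite)
  finally have *: "emeasure lborel ?C < \<infinity>" .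
  have "sphere (0::'a) 1 \<in> sets (restrict_space borel (sphere 0 1))"
    using sets.top [of "restrict_space borel (sphere (0::'a) 1)"] by (simp add: space_restrict_space)
  from emeasure_sphere_measure [OF this] *
  show "emeasure sphere_measure (space sphere_measure :: 'a set) \<noteq> \<infinity>"
    by (simp add: ennreal_mult_eq_top_iff)
qed

section \<open>The complex Hilbert space \<open>L\<^sup>2(S\<^sup>m)\<close>\<close>

definition L2_fun :: "'a measure \<Rightarrow> ('a \<Rightarrow> complex) set" where
  "L2_fun M = {f \<in> borel_measurable M. integrable M (\<lambda>x. (cmod (f x))\<^sup>2)}"

lemma L2_funD:
  assumes "f \<in> L2_fun M"
  shows "f \<in> borel_measurable M" "integrable M (\<lambda>x. (cmod (f x))\<^sup>2)"
  using assms by (auto simp: L2_fun_def)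

lemma L2_fun_integrable_mult:
  assumes f: "f \<in> L2_fun M" and g: "g \<in> L2_fun M"
  shows "integrable M (\<lambda>x. f x * g x)"
proof (rule Bochner_Integration.integrable_bound)
  show "integrable M (\<lambda>x. (cmod (f x))\<^sup>2 + (cmod (g x))\<^sup>2)"
    using L2_funD(2) [OF f] L2_funD(2) [OF g] by (rule Bochner_Integration.integrable_add)
  show "(\<lambda>x. f x * g x) \<in> borel_measurable M"
    using L2_funD(1) [OF f] L2_funD(1) [OF g] by measurable
  have "cmod (f x * g x) \<le> (cmod (f x))\<^sup>2 + (cmod (g x))\<^sup>2" for x
  proof -
    have "0 \<le> cmod (f x) * cmod (g x)" by simp
    with sum_squares_bound [of "cmod (f x)" "cmod (g x)"] show ?thesis
      unfolding norm_mult by linarith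
  qed
  then show "AE x in M. norm (f x * g x) \<le> norm ((cmod (f x))\<^sup>2 + (cmod (g x))\<^sup>2)"
    by (auto intro!: always_eventually)
qed

lemma L2_fun_cnj:
  assumes "f \<in> L2_fun M"
  shows "(\<lambda>x. cnj (f x)) \<in> L2_fun M"
proof -
  have "(\<lambda>x. cnj (f x)) \<in> borel_measurable M"
    by (rule borel_measurable_continuous_on [OF _ L2_funD(1) [OF assms]])
       (intro continuous_intros)
  then show ?thesis
    using L2_funD(2) [OF assms] by (simp add: L2_fun_def)
qed

lemma L2_fun_zero: "(\<lambda>x. 0) \<in> L2_fun M"
  by (simp add: L2_fun_def)

lemma L2_fun_scale:
  assumes "f \<in> L2_fun M"
  shows "(\<lambda>x. c * f x) \<in> L2_fun M"
  using L2_funD [OF assms] by (auto simp: L2_fun_def norm_mult power_mult_distrib)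

lemma L2_fun_add:
  assumes f: "f \<in> L2_fun M" and g: "g \<in> L2_fun M"
  shows "(\<lambda>x. f x + g x) \<in> L2_fun M"
proof -
  have "integrable M (\<lambda>x. (cmod (f x + g x))\<^sup>2)"
  proof (rule Bochner_Integration.integrable_bound)
    show "integrable M (\<lambda>x. 2 * (cmod (f x))\<^sup>2 + 2 * (cmod (g x))\<^sup>2)"
      using L2_funD(2) [OF f] L2_funD(2) [OF g]
      by (intro Bochner_Integration.integrable_add integrable_mult_right)
    show "(\<lambda>x. (cmod (f x + g x))\<^sup>2) \<in> borel_measurable M"
      using L2_funD(1) [OF f] L2_funD(1) [OF g] by measurable
    have "(cmod (f x + g x))\<^sup>2 \<le> 2 * (cmod (f x))\<^sup>2 + 2 * (cmod (g x))\<^sup>2" for x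
    proof -
      have "(cmod (f x + g x))\<^sup>2 \<le> (cmod (f x) + cmod (g x))\<^sup>2"
        by (intro power_mono norm_triangle_ineq norm_ge_zero)
      also have "\<dots> \<le> 2 * (cmod (f x))\<^sup>2 + 2 * (cmod (g x))\<^sup>2"
        using sum_squares_bound [of "cmod (f x)" "cmod (g x)"] by (simp add: power2_sum)
      finally show ?thesis .
    qed
    then show "AE x in M. norm ((cmod (f x + g x))\<^sup>2)
                 \<le> norm (2 * (cmod (f x))\<^sup>2 + 2 * (cmod (g x))\<^sup>2)"
      by (auto intro!: always_eventually)
  qed
  then show ?thesis
    using L2_funD(1) [OF f] L2_funD(1) [OF g] by (simp add: L2_fun_def)
qed

definition L2_eq :: "('a::euclidean_space \<Rightarrow> complex) \<Rightarrow> ('a \<Rightarrow> complex) \<Rightarrow> bool" where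
  "L2_eq f g \<longleftrightarrow> f \<in> L2_fun sphere_measure \<and> g \<in> L2_fun sphere_measure \<and>
                (AE x in sphere_measure. f x = g x)"

quotient_type (overloaded) 'a sphere_L2 = "'a::euclidean_space \<Rightarrow> complex" / partial: L2_eq
proof (rule part_equivpI)
  show "\<exists>f::'a \<Rightarrow> complex. L2_eq f f"
    using L2_fun_zero by (auto simp: L2_eq_def)
  show "symp (L2_eq :: ('a \<Rightarrow> complex) \<Rightarrow> _)"
    by (auto simp: symp_def L2_eq_def)
  show "transp (L2_eq :: ('a \<Rightarrow> complex) \<Rightarrow> _)"
    by (auto simp: transp_def L2_eq_def elim: eventually_elim2)
qed

instantiation sphere_L2 :: (euclidean_space) real_vector
begin

lift_definition zero_sphere_L2 :: "'a sphere_L2" is "\<lambda>x. 0"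
  by (simp add: L2_eq_def L2_fun_zero)

lift_definition plus_sphere_L2 :: "'a sphere_L2 \<Rightarrow> 'a sphere_L2 \<Rightarrow> 'a sphere_L2"
  is "\<lambda>f g x. f x + g x"
  by (auto simp: L2_eq_def intro: L2_fun_add)

lift_definition uminus_sphere_L2 :: "'a sphere_L2 \<Rightarrow> 'a sphere_L2" is "\<lambda>f x. - f x"
  using L2_fun_scale [of _ _ "-1"] by (auto simp: L2_eq_def)

lift_definition scaleR_sphere_L2 :: "real \<Rightarrow> 'a sphere_L2 \<Rightarrow> 'a sphere_L2"
  is "\<lambda>r f x. of_real r * f x"
  by (auto simp: L2_eq_def intro: L2_fun_scale)

definition minus_sphere_L2 :: "'a sphere_L2 \<Rightarrow> 'a sphere_L2 \<Rightarrow> 'a sphere_L2" where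
  "f - g = f + (- g)" for f g :: "'a sphere_L2"

instance
proof
  fix a b c :: "'a sphere_L2" and r s :: real
  show "a + b + c = a + (b + c)"
    by transfer (auto simp: L2_eq_def algebra_simps intro: L2_fun_add)
  show "a + b = b + a"
    by transfer (auto simp: L2_eq_def algebra_simps intro: L2_fun_add)
  show "0 + a = a"
    by transfer (auto simp: L2_eq_def)
  show "- a + a = 0"
    by transfer (auto simp: L2_eq_def L2_fun_zero)
  show "a - b = a + - b"
    by (rule minus_sphere_L2_def)
  show "r *\<^sub>R (a + b) = r *\<^sub>R a + r *\<^sub>R b"
    by transfer (auto simp: L2_eq_def distrib_left distrib_right intro!: L2_fun_add L2_fun_scale)
  show "(r + s) *\<^sub>R a = r *\<^sub>R a + s *\<^sub>R a"
    by transfer (auto simp: L2_eq_def distrib_left distrib_right intro!: L2_fun_add L2_fun_scale)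
  show "r *\<^sub>R s *\<^sub>R a = (r * s) *\<^sub>R a"
    by transfer (auto simp: L2_eq_def mult.assoc intro!: L2_fun_scale)
  show "1 *\<^sub>R a = a"
    by transfer (auto simp: L2_eq_def)
qed

end

lift_definition scaleC :: "complex \<Rightarrow> 'a::euclidean_space sphere_L2 \<Rightarrow> 'a sphere_L2"
  is "\<lambda>c f x. c * f x"
  by (auto simp: L2_eq_def intro: L2_fun_scale)

interpretation sphere_L2: vector_space "scaleC :: complex \<Rightarrow> 'a::euclidean_space sphere_L2 \<Rightarrow> _"
proof
  fix c d :: complex and f g :: "'a sphere_L2"
  show "scaleC c (f + g) = scaleC c f + scaleC c g"
    by transfer (auto simp: L2_eq_def distrib_left distrib_right intro!: L2_fun_add L2_fun_scale)
  show "scaleC (c + d) f = scaleC c f + scaleC d f"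
    by transfer (auto simp: L2_eq_def distrib_left distrib_right intro!: L2_fun_add L2_fun_scale)
  show "scaleC c (scaleC d f) = scaleC (c * d) f"
    by transfer (auto simp: L2_eq_def mult.assoc intro!: L2_fun_scale)
  show "scaleC 1 f = f"
    by transfer (auto simp: L2_eq_def)
qed

lift_definition cinner :: "'a::euclidean_space sphere_L2 \<Rightarrow> 'a sphere_L2 \<Rightarrow> complex"
  is "\<lambda>f g. LINT x|sphere_measure. f x * cnj (g x)"
proof -
  fix f f' g g' :: "'a \<Rightarrow> complex"
  assume *: "L2_eq f f'" "L2_eq g g'"
  have m: "(\<lambda>x. f x * cnj (g x)) \<in> borel_measurable sphere_measure"
    "(\<lambda>x. f' x * cnj (g' x)) \<in> borel_measurable sphere_measure"
    using * by (auto simp: L2_eq_def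
        intro!: borel_measurable_integrable L2_fun_integrable_mult L2_fun_cnj)
  from * have "AE x in sphere_measure. f x * cnj (g x) = f' x * cnj (g' x)"
    by (auto simp: L2_eq_def)
  with m show "(LINT x|sphere_measure. f x * cnj (g x)) = (LINT x|sphere_measure. f' x * cnj (g' x))"
    by (intro integral_cong_AE) auto
qed

lemma cinner_self_Re:
  "(LINT x|sphere_measure. f x * cnj (f x)) =
     complex_of_real (LINT x|sphere_measure. (cmod (f x))\<^sup>2)"
  by (simp only: complex_norm_square [symmetric] of_real_power [symmetric] integral_complex_of_real)

instantiation sphere_L2 :: (euclidean_space) real_inner
begin

definition inner_sphere_L2 :: "'a sphere_L2 \<Rightarrow> 'a sphere_L2 \<Rightarrow> real" where
  "inner_sphere_L2 f g = Re (cinner f g)"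

definition norm_sphere_L2 :: "'a sphere_L2 \<Rightarrow> real" where
  "norm_sphere_L2 f = sqrt (f \<bullet> f)"

definition sgn_sphere_L2 :: "'a sphere_L2 \<Rightarrow> 'a sphere_L2" where
  "sgn_sphere_L2 f = f /\<^sub>R norm f"

definition dist_sphere_L2 :: "'a sphere_L2 \<Rightarrow> 'a sphere_L2 \<Rightarrow> real" where
  "dist_sphere_L2 f g = norm (f - g)"

definition uniformity_sphere_L2 :: "('a sphere_L2 \<times> 'a sphere_L2) filter" where
  "uniformity_sphere_L2 = (INF e\<in>{0<..}. principal {(f, g). dist f g < e})"

definition open_sphere_L2 :: "'a sphere_L2 set \<Rightarrow> bool" where
  "open_sphere_L2 U \<longleftrightarrow> (\<forall>x\<in>U. eventually (\<lambda>(x', y). x' = x \<longrightarrow> y \<in> U) uniformity)"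

instance
proof
  fix f g h :: "'a sphere_L2" and r :: real
  show "dist f g = norm (f - g)" by (rule dist_sphere_L2_def)
  show "sgn f = f /\<^sub>R norm f" by (rule sgn_sphere_L2_def)
  show "uniformity = (INF e\<in>{0<..}. principal {(f, g::'a sphere_L2). dist f g < e})"
    by (rule uniformity_sphere_L2_def)
  show "open U \<longleftrightarrow> (\<forall>x\<in>U. eventually (\<lambda>(x', y). x' = x \<longrightarrow> y \<in> U) uniformity)"
    for U :: "'a sphere_L2 set"
    by (rule open_sphere_L2_def)
  show "norm f = sqrt (f \<bullet> f)" by (rule norm_sphere_L2_def)
  have cnj_int: "integrable M (\<lambda>x. f x * cnj (g x))"
    if "f \<in> L2_fun M" "g \<in> L2_fun M" for f g and M :: "'a measure"
    using that by (intro L2_fun_integrable_mult L2_fun_cnj)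
  show "f \<bullet> g = g \<bullet> f"
    unfolding inner_sphere_L2_def
  proof transfer
    fix f g :: "'a \<Rightarrow> complex"
    have "(LINT x|sphere_measure. g x * cnj (f x)) =
            cnj (LINT x|sphere_measure. f x * cnj (g x))"
      unfolding Bochner_Integration.integral_cnj [symmetric] by (simp add: mult.commute)
    then show "Re (LINT x|sphere_measure. f x * cnj (g x)) =
                 Re (LINT x|sphere_measure. g x * cnj (f x))"
      by simp
  qed
  show "(f + g) \<bullet> h = f \<bullet> h + g \<bullet> h"
    unfolding inner_sphere_L2_def
    by transfer (auto simp: L2_eq_def algebra_simps cnj_int)
  show "(r *\<^sub>R f) \<bullet> g = r * (f \<bullet> g)"
    unfolding inner_sphere_L2_def
  proof transfer
    fix r :: real and f g :: "'a \<Rightarrow> complex"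
    have "(LINT x|sphere_measure. of_real r * f x * cnj (g x)) =
            of_real r * (LINT x|sphere_measure. f x * cnj (g x))"
      by (simp add: mult.assoc)
    then show "Re (LINT x|sphere_measure. of_real r * f x * cnj (g x)) =
                 r * Re (LINT x|sphere_measure. f x * cnj (g x))"
      by simp
  qed
  show "0 \<le> f \<bullet> f"
    unfolding inner_sphere_L2_def
    by transfer (simp add: cinner_self_Re)
  show "f \<bullet> f = 0 \<longleftrightarrow> f = 0"
    unfolding inner_sphere_L2_def
  proof transfer
    fix f :: "'a \<Rightarrow> complex"
    assume "L2_eq f f"
    then have f: "f \<in> L2_fun sphere_measure" by (simp add: L2_eq_def)
    have "(LINT x|sphere_measure. (cmod (f x))\<^sup>2) = 0 \<longleftrightarrow>
            (AE x in sphere_measure. (cmod (f x))\<^sup>2 = 0)"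
      by (rule integral_nonneg_eq_0_iff_AE) (use L2_funD [OF f] in auto)
    then show "Re (LINT x|sphere_measure. f x * cnj (f x)) = 0 \<longleftrightarrow> L2_eq f (\<lambda>x. 0)"
      using f by (simp add: cinner_self_Re L2_eq_def L2_fun_zero)
  qed
qed

end

section \<open>Operators on \<open>L\<^sup>2(S\<^sup>m)\<close> and approximation numbers\<close>

text \<open>The library predicate \<^const>\<open>bounded_linear\<close> only provides real linearity.\<close>

definition bounded_clinear ::
    "('a::euclidean_space sphere_L2 \<Rightarrow> 'a sphere_L2) \<Rightarrow> bool" where
  "bounded_clinear T \<longleftrightarrow> bounded_linear T \<and> (\<forall>c f. T (scaleC c f) = scaleC c (T f))"

definition rank_le :: "('a::euclidean_space sphere_L2 \<Rightarrow> 'a sphere_L2) \<Rightarrow> nat \<Rightarrow> bool" where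
  "rank_le U k \<longleftrightarrow> (\<exists>S. finite S \<and> card S \<le> k \<and> range U \<subseteq> sphere_L2.span S)"

text \<open>
  Approximation numbers are indexed by \<open>n \<ge> 1\<close>.  For compact \<open>T\<close> the infimum is a minimum.
\<close>

definition approx_number ::
    "nat \<Rightarrow> ('a::euclidean_space sphere_L2 \<Rightarrow> 'a sphere_L2) \<Rightarrow> real" where
  "approx_number n T =
     Inf {onorm (\<lambda>f. T f - U f) | U. bounded_clinear U \<and> rank_le U (n - 1)}"

definition positive_operator ::
    "('a::euclidean_space sphere_L2 \<Rightarrow> 'a sphere_L2) \<Rightarrow> bool" where
  "positive_operator T \<longleftrightarrow> (\<forall>f. cinner (T f) f \<in> \<real>\<^sub>\<ge>\<^sub>0)"

text \<open>
  The square root of a bounded positive operator \<open>T\<close> is the unique bounded positive \<open>S\<close> with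
  \<open>S\<^sup>2 = T\<close>; it is treated as a relation between \<open>S\<close> and \<open>T\<close>.
\<close>

definition is_sqrt_operator ::
    "('a::euclidean_space sphere_L2 \<Rightarrow> 'a sphere_L2) \<Rightarrow> ('a sphere_L2 \<Rightarrow> 'a sphere_L2) \<Rightarrow> bool" where
  "is_sqrt_operator S T \<longleftrightarrow> bounded_clinear S \<and> positive_operator S \<and> (\<forall>f. S (S f) = T f)"

section \<open>Integral operators\<close>

definition integral_operator ::
    "('a::euclidean_space \<Rightarrow> 'a \<Rightarrow> complex) \<Rightarrow> 'a sphere_L2 \<Rightarrow> 'a sphere_L2" where
  "integral_operator K f =
     abs_sphere_L2 (\<lambda>x. LINT y|sphere_measure. K x y * rep_sphere_L2 f y)"

text \<open>
  A kernel generating a bounded operator need not be square integrable, so the convergence of the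
  defining integral is part of the following relation.  For square integrable kernels it agrees
  with \<^const>\<open>integral_operator\<close>, see \<open>generated_by_kernel_integral_operator\<close> below.
\<close>

definition generated_by_kernel ::
    "('a::euclidean_space sphere_L2 \<Rightarrow> 'a sphere_L2) \<Rightarrow> ('a \<Rightarrow> 'a \<Rightarrow> complex) \<Rightarrow> bool" where
  "generated_by_kernel T K \<longleftrightarrow>
     case_prod K \<in> borel_measurable (sphere_measure \<Otimes>\<^sub>M sphere_measure) \<and>
     (\<forall>f. AE x in sphere_measure.
        has_bochner_integral sphere_measure (\<lambda>y. K x y * rep_sphere_L2 f y) (rep_sphere_L2 (T f) x))"

lemma rep_sphere_L2_in: "rep_sphere_L2 f \<in> L2_fun sphere_measure"
  using Quotient3_rep_reflp [OF Quotient3_sphere_L2, of f] by (simp add: L2_eq_def)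

lemma rep_abs_sphere_L2:
  assumes "f \<in> L2_fun sphere_measure"
  shows "AE x in sphere_measure. rep_sphere_L2 (abs_sphere_L2 f) x = f x"
proof -
  have "L2_eq f f" using assms by (simp add: L2_eq_def)
  then have "L2_eq (rep_sphere_L2 (abs_sphere_L2 f)) f"
    by (rule rep_abs_rsp_left [OF Quotient3_sphere_L2])
  then show ?thesis by (simp add: L2_eq_def)
qed

lemma L2_Cauchy_Schwarz:
  fixes f g :: "'a::euclidean_space \<Rightarrow> complex"
  assumes f: "f \<in> L2_fun sphere_measure" and g: "g \<in> L2_fun sphere_measure"
  shows "(cmod (LINT x|sphere_measure. f x * g x))\<^sup>2 \<le>
           (LINT x|sphere_measure. (cmod (f x))\<^sup>2) * (LINT x|sphere_measure. (cmod (g x))\<^sup>2)"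
proof -
  define F G where "F = abs_sphere_L2 (\<lambda>x. complex_of_real (cmod (f x)))"
    and "G = abs_sphere_L2 (\<lambda>x. complex_of_real (cmod (g x)))"
  have *: "(\<lambda>x. complex_of_real (cmod (h x))) \<in> L2_fun sphere_measure"
    if "h \<in> L2_fun sphere_measure" for h :: "'a \<Rightarrow> complex"
    using L2_funD [OF that] by (simp add: L2_fun_def)
  have inner: "inner (abs_sphere_L2 (\<lambda>x. complex_of_real (cmod (h x))))
                 (abs_sphere_L2 (\<lambda>x. complex_of_real (cmod (k x)))) =
               (LINT x|sphere_measure. cmod (h x) * cmod (k x))"
    if "h \<in> L2_fun sphere_measure" "k \<in> L2_fun sphere_measure" for h k :: "'a \<Rightarrow> complex"
  proof -
    have "cinner (abs_sphere_L2 (\<lambda>x. complex_of_real (cmod (h x))))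
            (abs_sphere_L2 (\<lambda>x. complex_of_real (cmod (k x)))) =
          (LINT x|sphere_measure. complex_of_real (cmod (h x)) * cnj (complex_of_real (cmod (k x))))"
      by (rule cinner.abs_eq) (use * that in \<open>auto simp: L2_eq_def\<close>)
    then show ?thesis
      unfolding inner_sphere_L2_def
      by (simp only: complex_cnj_complex_of_real of_real_mult [symmetric] integral_complex_of_real
            Re_complex_of_real)
  qed
  have "cmod (LINT x|sphere_measure. f x * g x) \<le> (LINT x|sphere_measure. cmod (f x * g x))"
    by (rule integral_norm_bound)
  also have "\<dots> = inner F G"
    unfolding F_def G_def norm_mult by (rule inner [OF f g, symmetric])
  finally have "(cmod (LINT x|sphere_measure. f x * g x))\<^sup>2 \<le> (inner F G)\<^sup>2"
    by (intro power_mono) auto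
  also have "\<dots> \<le> inner F F * inner G G"
    by (rule Cauchy_Schwarz_ineq)
  also have "\<dots> = (LINT x|sphere_measure. (cmod (f x))\<^sup>2) * (LINT x|sphere_measure. (cmod (g x))\<^sup>2)"
    unfolding F_def G_def inner [OF f f] inner [OF g g] power2_eq_square ..
  finally show ?thesis .
qed

lemma generated_by_kernel_integral_operator:
  fixes K :: "'a::euclidean_space \<Rightarrow> 'a \<Rightarrow> complex"
  assumes K: "case_prod K \<in> L2_fun (sphere_measure \<Otimes>\<^sub>M sphere_measure)"
  shows "generated_by_kernel (integral_operator K) K"
  unfolding generated_by_kernel_def
proof (intro conjI allI)
  let ?S = "sphere_measure :: 'a measure"
  interpret finite_measure ?S by (rule finite_measure_sphere_measure)
  interpret P: pair_sigma_finite ?S ?S ..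
  show Km: "case_prod K \<in> borel_measurable (?S \<Otimes>\<^sub>M ?S)"
    by (rule L2_funD(1) [OF K])
  fix f :: "'a sphere_L2"
  let ?f = "rep_sphere_L2 f"
  have fL2: "?f \<in> L2_fun ?S" by (rule rep_sphere_L2_in)
  have fm: "?f \<in> borel_measurable ?S" by (rule L2_funD(1) [OF fL2])
  define h where "h = (\<lambda>x. LINT y|?S. K x y * ?f y)"
  have Kint: "integrable (?S \<Otimes>\<^sub>M ?S) (\<lambda>(x, y). (cmod (K x y))\<^sup>2)"
    using L2_funD(2) [OF K] by (simp add: case_prod_unfold)
  have KL2: "AE x in ?S. K x \<in> L2_fun ?S"
    using AE_space P.AE_integrable_fst [OF Kint]
  proof eventually_elim
    fix x assume "x \<in> space ?S" and "integrable ?S (\<lambda>y. (cmod (K x y))\<^sup>2)"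
    then show "K x \<in> L2_fun ?S"
      using measurable_Pair2 [OF Km] by (simp add: L2_fun_def)
  qed
  have hm: "h \<in> borel_measurable ?S"
    unfolding h_def
  proof (rule borel_measurable_lebesgue_integral)
    have "(\<lambda>p. case_prod K p * ?f (snd p)) \<in> borel_measurable (?S \<Otimes>\<^sub>M ?S)"
      using Km fm by measurable
    then show "(\<lambda>(x, y). K x y * ?f y) \<in> borel_measurable (?S \<Otimes>\<^sub>M ?S)"
      by (simp add: case_prod_unfold)
  qed
  have bound: "AE x in ?S. norm ((cmod (h x))\<^sup>2) \<le>
      norm ((LINT y|?S. (cmod (K x y))\<^sup>2) * (LINT y|?S. (cmod (?f y))\<^sup>2))"
    using KL2
  proof eventually_elim
    fix x assume "K x \<in> L2_fun ?S"
    from L2_Cauchy_Schwarz [OF this fL2]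
    show "norm ((cmod (h x))\<^sup>2) \<le>
      norm ((LINT y|?S. (cmod (K x y))\<^sup>2) * (LINT y|?S. (cmod (?f y))\<^sup>2))"
      unfolding h_def by simp
  qed
  have "integrable ?S (\<lambda>x. (cmod (h x))\<^sup>2)"
  proof (rule Bochner_Integration.integrable_bound [OF _ _ bound])
    show "integrable ?S (\<lambda>x. (LINT y|?S. (cmod (K x y))\<^sup>2) * (LINT y|?S. (cmod (?f y))\<^sup>2))"
      using P.integrable_fst [OF Kint] by (rule integrable_mult_left)
  qed (use hm in measurable)
  with hm have "h \<in> L2_fun ?S" by (simp add: L2_fun_def)
  then have "AE x in ?S. rep_sphere_L2 (integral_operator K f) x = h x"
    unfolding integral_operator_def h_def by (rule rep_abs_sphere_L2)
  with KL2 show "AE x in ?S. has_bochner_integral ?S (\<lambda>y. K x y * ?f y)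
                   (rep_sphere_L2 (integral_operator K f) x)"
  proof eventually_elim
    fix x assume "K x \<in> L2_fun ?S" "rep_sphere_L2 (integral_operator K f) x = h x"
    then show "has_bochner_integral ?S (\<lambda>y. K x y * ?f y) (rep_sphere_L2 (integral_operator K f) x)"
      using L2_fun_integrable_mult [OF _ fL2] by (simp add: has_bochner_integral_iff h_def)
  qed
qed

text \<open>
  The last clause includes that \<open>x \<mapsto> K\<^sub>1\<^sub>/\<^sub>2(x,y) K\<^sub>1\<^sub>/\<^sub>2(w,x)\<close> is integrable for all \<open>y\<close> and \<open>w\<close>.
\<close>

definition positive_integral_operator ::
    "('a::euclidean_space \<Rightarrow> 'a \<Rightarrow> complex) \<Rightarrow> bool" where
  "positive_integral_operator K \<longleftrightarrow>
     case_prod K \<in> L2_fun (sphere_measure \<Otimes>\<^sub>M sphere_measure) \<and>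
     positive_operator (integral_operator K) \<and>
     (\<exists>S Kh. is_sqrt_operator S (integral_operator K) \<and> generated_by_kernel S Kh \<and>
        (\<forall>x\<in>sphere 0 1. \<forall>y\<in>sphere 0 1. Kh x y = cnj (Kh y x)) \<and>
        (\<forall>y\<in>sphere 0 1. \<forall>w\<in>sphere 0 1.
           has_bochner_integral sphere_measure (\<lambda>x. Kh x y * Kh w x) (K w y)))"

section \<open>Averages over spherical caps\<close>

definition cap :: "real \<Rightarrow> 'a::euclidean_space \<Rightarrow> 'a set" where
  "cap t x = {y \<in> sphere 0 1. cos t \<le> x \<bullet> y}"

definition cap_average :: "real \<Rightarrow> ('a::euclidean_space \<Rightarrow> complex) \<Rightarrow> 'a \<Rightarrow> complex" where
  "cap_average t f x =
     (LINT w:cap t x|sphere_measure. f w) /\<^sub>R measure sphere_measure (cap t x)"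

text \<open>
  For a positive integral operator every \<open>K(y,\<cdot>)\<close> is square integrable (it is the complex conjugate
  of a representative of the square root applied to \<open>K\<^sub>1\<^sub>/\<^sub>2(\<cdot>,y)\<close>), so the averages are meaningful.
\<close>

definition averaged_holder ::
    "('a::euclidean_space \<Rightarrow> real) \<Rightarrow> real \<Rightarrow> ('a \<Rightarrow> 'a \<Rightarrow> complex) \<Rightarrow> bool" where
  "averaged_holder B \<beta> K \<longleftrightarrow>
     (\<forall>x\<in>sphere 0 1. \<forall>y\<in>sphere 0 1. \<forall>t\<in>{0<..<pi}.
        cmod (cap_average t (K y) x - K y x) \<le> B y * t powr \<beta>)"

text \<open>Some element of the equivalence class \<open>f\<close> is continuous on the sphere.\<close>

definition has_continuous_representative :: "'a::euclidean_space sphere_L2 \<Rightarrow> bool" where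
  "has_continuous_representative f \<longleftrightarrow>
     (\<exists>g. continuous_on (sphere 0 1) g \<and> (AE x in sphere_measure. rep_sphere_L2 f x = g x))"

end

theory Submission
  imports Defs
begin

text \<open>
  Let \<open>\<sigma>\<close> be the surface measure, \<open>S\<close> the square root of the integral operator of \<open>K\<close>, with
  hermitian kernel \<open>Kh\<close>, and \<open>M\<close> the averaging operator over caps of radius \<open>t\<close>.  The value \<open>K y w\<close>
  is the inner product of the rows \<open>Kh y\<close> and \<open>Kh w\<close>.  Expanding a square therefore gives

  \<open>\<integral>\<integral> 1[y \<bullet> w \<ge> cos t] \<parallel>Kh y - Kh w\<parallel>\<^sup>2 = 2 \<integral> \<sigma>(cap t y) Re (K y y - (average of K y over cap t y)) dy\<close>,

  and by the averaged Hoelder condition at the diagonal the right-hand side is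
  \<open>O(t powr (m + \<beta>))\<close>, because a cap has measure of order \<open>t ^ m\<close> (\<open>integral_deviation\<close>,
  \<open>measure_cap_ge\<close>, \<open>measure_cap_le\<close>).  The kernel of \<open>S - M S\<close> is the average of
  \<open>Kh y x - Kh w x\<close> over \<open>w\<close> in the cap around \<open>y\<close>, so Cauchy-Schwarz bounds the square of its
  Hilbert-Schmidt norm by \<open>O(t powr \<beta>)\<close> (\<open>hs_le_remainder\<close>).

  The rows of the kernel of \<open>M\<close> are normalized indicators of caps, so the square of its
  Hilbert-Schmidt norm is \<open>O(1 / t ^ m)\<close>.  Hence there is an orthogonal projection \<open>P\<close> of rank
  \<open>r = O(1 / t ^ m)\<close> such that \<open>A = M (1 - P)\<close> has norm at most \<open>1/2\<close>.  In the identity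
  \<open>S = (S - M S) + M P S + A S\<close> the last term can be expanded in a Neumann series: up to an
  operator of rank \<open>r\<close>, the square of the Hilbert-Schmidt norm of \<open>S\<close> is \<open>O(t powr \<beta>)\<close>
  (\<open>hs_split_finite_rank\<close>).  Removing \<open>r\<close> more dimensions leaves an operator \<open>E\<close> with
  \<open>\<parallel>E\<parallel>\<^sup>2 = O(t powr \<beta> / r)\<close>, and \<open>S S\<close> differs from \<open>E E\<close> by an operator of rank at most \<open>4 r\<close>
  (\<open>approx_number_square_le\<close>).

  With \<open>t\<close> a multiple of \<open>n powr (-1/m)\<close>, so that \<open>r\<close> is a fraction of \<open>n\<close>, this is the rate
  \<open>n powr (-1 - \<beta>/m)\<close>, from which the rate \<open>n powr (-\<beta>/m)\<close> follows.
\<close>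

section \<open>Inner product and bounded operators\<close>

lemma cinner_add_left: "cinner (f + g) h = cinner f h + cinner g h"
proof transfer
  fix f g h :: "'a \<Rightarrow> complex"
  assume "L2_eq f f" "L2_eq g g" "L2_eq h h"
  then have "integrable sphere_measure (\<lambda>x. f x * cnj (h x))"
    "integrable sphere_measure (\<lambda>x. g x * cnj (h x))"
    by (auto simp: L2_eq_def intro!: L2_fun_integrable_mult L2_fun_cnj)
  then show "(LINT x|sphere_measure. (f x + g x) * cnj (h x)) =
      (LINT x|sphere_measure. f x * cnj (h x)) + (LINT x|sphere_measure. g x * cnj (h x))"
    by (simp add: distrib_right)
qed

lemma cinner_scaleC_left: "cinner (scaleC c f) g = c * cinner f g"
  by transfer (simp add: mult.assoc)

lemma cinner_commute: "cinner f g = cnj (cinner g f)"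
proof transfer
  fix f g :: "'a \<Rightarrow> complex"
  show "(LINT x|sphere_measure. f x * cnj (g x)) = cnj (LINT x|sphere_measure. g x * cnj (f x))"
    unfolding Bochner_Integration.integral_cnj [symmetric] by (simp add: mult.commute)
qed

lemma cinner_self: "cinner f f = complex_of_real ((norm f)\<^sup>2)"
proof -
  have "cinner f f \<in> \<real>"
    by (metis cinner_commute Reals_cnj_iff)
  moreover have "Re (cinner f f) = (norm f)\<^sup>2"
    by (metis inner_sphere_L2_def power2_norm_eq_inner)
  ultimately show ?thesis
    by (metis of_real_Re)
qed

lemma cinner_zero_left: "cinner 0 f = 0"
  by (metis add_cancel_right_left cinner_add_left)

lemma cinner_sum_left: "cinner (sum F I) g = (\<Sum>i\<in>I. cinner (F i) g)"
  by (induction I rule: infinite_finite_induct) (simp_all add: cinner_add_left cinner_zero_left)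

lemma scaleR_eq_scaleC: "r *\<^sub>R f = scaleC (complex_of_real r) f"
  by transfer (auto simp: L2_eq_def intro: L2_fun_scale)

lemma norm_scaleC: "norm (scaleC c f) = cmod c * norm f"
proof -
  have "cinner (scaleC c f) (scaleC c f) = c * cnj c * cinner f f"
    by (metis (no_types, opaque_lifting) cinner_commute cinner_scaleC_left complex_cnj_cnj
        complex_cnj_mult mult.assoc)
  then have "complex_of_real ((norm (scaleC c f))\<^sup>2) = complex_of_real ((cmod c * norm f)\<^sup>2)"
    by (simp only: cinner_self complex_norm_square [symmetric] of_real_mult [symmetric]
        power_mult_distrib)
  then show ?thesis
    by (metis mult_nonneg_nonneg norm_ge_zero of_real_eq_iff power2_eq_iff_nonneg)
qed

text \<open>
  The real Cauchy-Schwarz inequality applies once \<open>f\<close> is rotated so that the inner product becomes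
  real and nonnegative.
\<close>

lemma cmod_cinner_le: "cmod (cinner f g) \<le> norm f * norm g"
proof (cases "cinner f g = 0")
  case False
  define c where "c = cnj (cinner f g) / cmod (cinner f g)"
  have "cinner (scaleC c f) g = cmod (cinner f g)"
  proof -
    have "cnj (cinner f g) * cinner f g = complex_of_real (cmod (cinner f g)) * cmod (cinner f g)"
      by (simp only: complex_norm_square [symmetric] mult.commute [of "cnj _"] power2_eq_square
          of_real_mult)
    with False show ?thesis
      by (simp add: c_def cinner_scaleC_left)
  qed
  then have "cmod (cinner f g) = inner (scaleC c f) g"
    by (simp add: inner_sphere_L2_def)
  also have "\<dots> \<le> norm (scaleC c f) * norm g"
    by (rule norm_cauchy_schwarz)
  also have "norm (scaleC c f) = norm f"
    using False by (simp add: norm_scaleC c_def norm_divide)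
  finally show ?thesis .
qed auto

lemma bounded_clinearI:
  assumes "\<And>f g. T (f + g) = T f + T g" "\<And>c f. T (scaleC c f) = scaleC c (T f)"
    and "\<And>f. norm (T f) \<le> C * norm f"
  shows "bounded_clinear T"
proof -
  have "bounded_linear T"
    by (rule bounded_linear_intro [of T C]) (use assms in \<open>auto simp: scaleR_eq_scaleC mult.commute\<close>)
  then show ?thesis
    using assms(2) by (simp add: bounded_clinear_def)
qed

lemma bounded_clinear_add: "bounded_clinear T \<Longrightarrow> T (f + g) = T f + T g"
  and bounded_clinear_scaleC: "bounded_clinear T \<Longrightarrow> T (scaleC c f) = scaleC c (T f)"
  and bounded_clinear_diff: "bounded_clinear T \<Longrightarrow> T (f - g) = T f - T g"
  by (auto simp: bounded_clinear_def linear_simps)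

lemma bounded_clinear_compose:
  "bounded_clinear S \<Longrightarrow> bounded_clinear T \<Longrightarrow> bounded_clinear (\<lambda>f. S (T f))"
  by (simp add: bounded_clinear_def bounded_linear_compose)

lemma bounded_clinear_plus:
  "bounded_clinear S \<Longrightarrow> bounded_clinear T \<Longrightarrow> bounded_clinear (\<lambda>f. S f + T f)"
  by (simp add: bounded_clinear_def sphere_L2.scale_right_distrib bounded_linear_add)

lemma bounded_clinear_minus:
  "bounded_clinear S \<Longrightarrow> bounded_clinear T \<Longrightarrow> bounded_clinear (\<lambda>f. S f - T f)"
  by (simp add: bounded_clinear_def sphere_L2.scale_right_diff_distrib bounded_linear_sub)

lemma bounded_clinear_ident: "bounded_clinear (\<lambda>f. f)"
  by (auto simp: bounded_clinear_def)

lemma bounded_clinear_zero: "bounded_clinear (\<lambda>f. 0)"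
  by (auto simp: bounded_clinear_def)

lemma bounded_clinear_sum:
  assumes "\<And>i. i \<in> I \<Longrightarrow> bounded_clinear (T i)"
  shows "bounded_clinear (\<lambda>f. \<Sum>i\<in>I. T i f)"
  using assms
proof (induction I rule: infinite_finite_induct)
  case (insert i I)
  then have "bounded_clinear (\<lambda>f. T i f + (\<Sum>i\<in>I. T i f))"
    by (intro bounded_clinear_plus) simp_all
  with insert show ?case by simp
qed (simp_all add: bounded_clinear_zero)

lemma bounded_clinear_funpow:
  assumes "bounded_clinear T"
  shows "bounded_clinear (T ^^ k)"
proof (induction k)
  case (Suc k)
  show ?case
    using bounded_clinear_compose [OF assms Suc] by (simp add: o_def)
qed (simp add: bounded_clinear_ident id_def)

section \<open>Finite rank and approximation numbers\<close>

lemma rank_le_mono: "rank_le U k \<Longrightarrow> k \<le> l \<Longrightarrow> rank_le U l"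
  unfolding rank_le_def by (meson order_trans)

lemma rank_le_precompose: "rank_le U k \<Longrightarrow> rank_le (\<lambda>f. U (T f)) k"
  unfolding rank_le_def by blast

lemma rank_le_postcompose:
  assumes T: "bounded_clinear T" and U: "rank_le U k"
  shows "rank_le (\<lambda>f. T (U f)) k"
proof -
  obtain S where S: "finite S" "card S \<le> k" "range U \<subseteq> sphere_L2.span S"
    using U unfolding rank_le_def by blast
  have "T f \<in> sphere_L2.span (T ` S)" if "f \<in> sphere_L2.span S" for f
    using that
  proof (induction rule: sphere_L2.span_induct_alt)
    case base
    then show ?case
      using bounded_clinear_scaleC [OF T, of 0 0] by (simp add: sphere_L2.span_zero)
  next
    case (step c x y)
    then show ?case
      by (simp add: bounded_clinear_add [OF T] bounded_clinear_scaleC [OF T] sphere_L2.span_add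
          sphere_L2.span_base sphere_L2.span_scale)
  qed
  with S have "range (\<lambda>f. T (U f)) \<subseteq> sphere_L2.span (T ` S)"
    by blast
  then show ?thesis
    unfolding rank_le_def using S card_image_le [OF S(1), of T]
    by (intro exI [of _ "T ` S"]) auto
qed

lemma rank_le_add:
  assumes "rank_le U k" "rank_le V l"
  shows "rank_le (\<lambda>f. U f + V f) (k + l)"
proof -
  obtain S where S: "finite S" "card S \<le> k" "range U \<subseteq> sphere_L2.span S"
    using assms(1) unfolding rank_le_def by blast
  obtain R where R: "finite R" "card R \<le> l" "range V \<subseteq> sphere_L2.span R"
    using assms(2) unfolding rank_le_def by blast
  have "U f + V f \<in> sphere_L2.span (S \<union> R)" for f
    using S(3) R(3) sphere_L2.span_mono [of S "S \<union> R"] sphere_L2.span_mono [of R "S \<union> R"]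
    by (intro sphere_L2.span_add) auto
  moreover have "card (S \<union> R) \<le> k + l"
    using card_Un_le [of S R] S(2) R(2) by linarith
  ultimately show ?thesis
    unfolding rank_le_def using S(1) R(1) by (intro exI [of _ "S \<union> R"]) auto
qed

lemma approx_number_le:
  assumes U: "bounded_clinear U" "rank_le U (n - 1)"
    and le: "\<And>f. norm (T f - U f) \<le> c * norm f" and "0 \<le> c"
    and T: "bounded_clinear T"
  shows "approx_number n T \<le> c"
proof -
  have "approx_number n T \<le> onorm (\<lambda>f. T f - U f)"
    unfolding approx_number_def
  proof (rule cInf_lower)
    show "bdd_below {onorm (\<lambda>f. T f - U f) |U. bounded_clinear U \<and> rank_le U (n - 1)}"
      using T by (intro bdd_belowI [of _ 0])
        (auto simp: bounded_clinear_def intro!: onorm_pos_le bounded_linear_sub)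
  qed (use U in auto)
  also have "\<dots> \<le> c"
    using assms by (intro onorm_bound) auto
  finally show ?thesis .
qed

lemma approx_number_nonneg:
  assumes T: "bounded_clinear T"
  shows "0 \<le> approx_number n T"
  unfolding approx_number_def
proof (rule cInf_greatest)
  have "rank_le (\<lambda>f. 0 :: 'a sphere_L2) (n - 1)"
    unfolding rank_le_def by (rule exI [of _ "{}"]) auto
  then show "{onorm (\<lambda>f. T f - U f) |U. bounded_clinear U \<and> rank_le U (n - 1)} \<noteq> {}"
    using bounded_clinear_zero by blast
qed (use T in \<open>auto simp: bounded_clinear_def intro!: onorm_pos_le bounded_linear_sub\<close>)

section \<open>Orthogonal projections and Hilbert-Schmidt bounds\<close>

definition orthonormal :: "'a::euclidean_space sphere_L2 set \<Rightarrow> bool" where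
  "orthonormal V \<longleftrightarrow> finite V \<and> (\<forall>v\<in>V. \<forall>w\<in>V. cinner v w = (if v = w then 1 else 0))"

definition projection :: "'a::euclidean_space sphere_L2 set \<Rightarrow> 'a sphere_L2 \<Rightarrow> 'a sphere_L2" where
  "projection V f = (\<Sum>v\<in>V. scaleC (cinner f v) v)"

lemma cinner_projection:
  assumes "orthonormal V" "v \<in> V"
  shows "cinner (projection V f) v = cinner f v"
proof -
  have "cinner (projection V f) v = (\<Sum>w\<in>V. if w = v then cinner f v else 0)"
    unfolding projection_def cinner_sum_left cinner_scaleC_left
    using assms by (intro sum.cong) (auto simp: orthonormal_def)
  also have "\<dots> = cinner f v"
    using assms by (simp add: orthonormal_def)
  finally show ?thesis .
qed

lemma cinner_diff_left: "cinner (f - g) h = cinner f h - cinner g h"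
  by (metis cinner_add_left diff_add_cancel eq_diff_eq)

text \<open>
  The last sum is the square of the norm of \<open>projection V f\<close>.
\<close>

lemma projection_pythagoras:
  assumes V: "orthonormal V"
  shows "(norm f)\<^sup>2 = (norm (f - projection V f))\<^sup>2 + (\<Sum>v\<in>V. (cmod (cinner f v))\<^sup>2)"
proof -
  let ?p = "projection V f"
  have eq: "cinner ?p h = (\<Sum>v\<in>V. cinner f v * cnj (cinner h v))" for h
    unfolding projection_def cinner_sum_left cinner_scaleC_left by (subst (2) cinner_commute) simp
  have 0: "cinner ?p (f - ?p) = 0"
    unfolding eq using V by (intro sum.neutral) (auto simp: cinner_diff_left cinner_projection)
  have "(norm f)\<^sup>2 = (norm ((f - ?p) + ?p))\<^sup>2"
    by simp
  also have "\<dots> = (norm (f - ?p))\<^sup>2 + (norm ?p)\<^sup>2 + 2 * inner ?p (f - ?p)"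
    unfolding power2_norm_eq_inner by (simp add: algebra_simps inner_commute)
  also have "inner ?p (f - ?p) = 0"
    by (simp add: inner_sphere_L2_def 0)
  also have "(norm ?p)\<^sup>2 = (\<Sum>v\<in>V. (cmod (cinner f v))\<^sup>2)"
  proof -
    have "complex_of_real ((norm ?p)\<^sup>2) = (\<Sum>v\<in>V. cinner f v * cnj (cinner ?p v))"
      unfolding cinner_self [symmetric] by (rule eq)
    also have "\<dots> = (\<Sum>v\<in>V. complex_of_real ((cmod (cinner f v))\<^sup>2))"
      using V by (intro sum.cong) (simp_all only: cinner_projection complex_norm_square)
    finally show ?thesis
      by (metis of_real_eq_iff of_real_sum)
  qed
  finally show ?thesis by simp
qed

lemma bessel: "orthonormal V \<Longrightarrow> (\<Sum>v\<in>V. (cmod (cinner f v))\<^sup>2) \<le> (norm f)\<^sup>2"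
  using projection_pythagoras [of V f] by simp

lemma norm_diff_projection_le:
  assumes "orthonormal V"
  shows "norm (f - projection V f) \<le> norm f"
  using projection_pythagoras [OF assms, of f]
  by (smt (verit) norm_ge_zero power2_le_imp_le sum_nonneg zero_le_power2)

lemma bounded_clinear_projection:
  assumes "orthonormal V"
  shows "bounded_clinear (projection V)"
  unfolding projection_def
proof (rule bounded_clinear_sum)
  fix v assume "v \<in> V"
  show "bounded_clinear (\<lambda>f. scaleC (cinner f v) v)"
  proof (rule bounded_clinearI [where C = "norm v * norm v"])
    fix f
    show "norm (scaleC (cinner f v) v) \<le> norm v * norm v * norm f"
      using mult_right_mono [OF cmod_cinner_le [of f v], of "norm v"]
      by (simp add: norm_scaleC mult_ac)
  qed (simp_all add: cinner_add_left sphere_L2.scale_left_distrib cinner_scaleC_left)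
qed

lemma rank_le_projection:
  assumes "orthonormal V"
  shows "rank_le (projection V) (card V)"
proof -
  have "projection V f \<in> sphere_L2.span V" for f
    unfolding projection_def
    by (intro sphere_L2.span_sum sphere_L2.span_scale sphere_L2.span_base)
  then show ?thesis
    using assms unfolding rank_le_def orthonormal_def by blast
qed

text \<open>
  The bound \<open>h\<close> is on the square of the Hilbert-Schmidt norm: the supremum of these sums over finite
  orthonormal sets is the sum over an orthonormal basis.
\<close>

definition hs_le :: "('a::euclidean_space sphere_L2 \<Rightarrow> 'a sphere_L2) \<Rightarrow> real \<Rightarrow> bool" where
  "hs_le T h \<longleftrightarrow> (\<forall>V. orthonormal V \<longrightarrow> (\<Sum>v\<in>V. (norm (T v))\<^sup>2) \<le> h)"

text \<open>
  As long as \<open>T\<close> is large somewhere on the orthogonal complement of \<open>V\<close>, a unit vector \<open>u\<close> of that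
  complement with \<open>h / q < \<parallel>T u\<parallel>\<^sup>2\<close> can be added to \<open>V\<close>.  This has to stop before \<open>V\<close> has more than
  \<open>q\<close> elements, since \<open>q\<close> such vectors would contribute more than \<open>h\<close> to the Hilbert-Schmidt sum.
\<close>

lemma hs_finite_rank_approximation:
  assumes T: "bounded_clinear T" and hs: "hs_le T h" and q: "0 < q"
  obtains V where "orthonormal V" "card V \<le> q"
    "\<And>f. (norm (T (f - projection V f)))\<^sup>2 \<le> h / q * (norm f)\<^sup>2"
proof -
  define good where "good V \<longleftrightarrow> (\<forall>f. (\<forall>v\<in>V. cinner f v = 0) \<longrightarrow> (norm (T f))\<^sup>2 \<le> h / q * (norm f)\<^sup>2)"
    for V
  have "\<exists>V. orthonormal V \<and> card V \<le> n \<and>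
      (good V \<or> card V = n \<and> (\<forall>v\<in>V. h / q < (norm (T v))\<^sup>2))" for n
  proof (induction n)
    case 0
    show ?case
      by (rule exI [of _ "{}"]) (simp add: orthonormal_def)
  next
    case (Suc n)
    then obtain V where V: "orthonormal V" "card V \<le> n"
      "good V \<or> card V = n \<and> (\<forall>v\<in>V. h / q < (norm (T v))\<^sup>2)" by blast
    show ?case
    proof (cases "good V")
      case True
      with V show ?thesis by (intro exI [of _ V]) auto
    next
      case False
      then obtain f where f: "\<forall>v\<in>V. cinner f v = 0" "h / q * (norm f)\<^sup>2 < (norm (T f))\<^sup>2"
        unfolding good_def by (auto simp: not_le)
      have "f \<noteq> 0"
        using f(2) bounded_clinear_scaleC [OF T, of 0 0] by auto
      define u where "u = scaleC (1 / norm f) f"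
      have u1: "cinner u u = 1"
        using \<open>f \<noteq> 0\<close> unfolding u_def cinner_self norm_scaleC by (simp add: norm_divide)
      have u0: "cinner u v = 0" "cinner v u = 0" if "v \<in> V" for v
        using f(1) that cinner_commute [of v u] by (auto simp: u_def cinner_scaleC_left)
      have "u \<notin> V" using u0 u1 by force
      have "norm (T u) = norm (T f) / norm f"
        unfolding u_def bounded_clinear_scaleC [OF T] norm_scaleC by (simp add: norm_divide)
      with f(2) \<open>f \<noteq> 0\<close> have "h / q < (norm (T u))\<^sup>2"
        by (simp add: power_divide pos_less_divide_eq)
      moreover have "orthonormal (insert u V)"
        using V(1) u0 u1 by (auto simp: orthonormal_def)
      ultimately show ?thesis
        using V False \<open>u \<notin> V\<close> by (intro exI [of _ "insert u V"]) (auto simp: orthonormal_def)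
    qed
  qed
  from this [of q] obtain V where V: "orthonormal V" "card V \<le> q"
    "good V \<or> card V = q \<and> (\<forall>v\<in>V. h / q < (norm (T v))\<^sup>2)" by blast
  have "good V"
  proof (rule ccontr)
    assume "\<not> good V"
    with V have c: "card V = q" "\<forall>v\<in>V. h / q < (norm (T v))\<^sup>2" by auto
    then have "finite V" "V \<noteq> {}" using q card_gt_0_iff by (auto intro: card_ge_0_finite)
    then have "(\<Sum>v\<in>V. h / q) < (\<Sum>v\<in>V. (norm (T v))\<^sup>2)"
      using c by (intro sum_strict_mono) auto
    then have "h < (\<Sum>v\<in>V. (norm (T v))\<^sup>2)"
      using c(1) q by simp
    with hs V(1) show False by (force simp: hs_le_def)
  qed
  show ?thesis
  proof (rule that [OF V(1,2)])
    fix f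
    have "hs_le T h \<Longrightarrow> 0 \<le> h"
      unfolding hs_le_def by (drule spec [of _ "{}"]) (simp add: orthonormal_def)
    then have "0 \<le> h / q" using hs by simp
    have "(norm (T (f - projection V f)))\<^sup>2 \<le> h / q * (norm (f - projection V f))\<^sup>2"
      using \<open>good V\<close> V(1) unfolding good_def by (auto simp: cinner_diff_left cinner_projection)
    also have "\<dots> \<le> h / q * (norm f)\<^sup>2"
      using norm_diff_projection_le [OF V(1)] \<open>0 \<le> h / q\<close>
      by (intro mult_left_mono power_mono) auto
    finally show "(norm (T (f - projection V f)))\<^sup>2 \<le> h / q * (norm f)\<^sup>2" .
  qed
qed

lemma hs_leD: "hs_le T h \<Longrightarrow> orthonormal V \<Longrightarrow> (\<Sum>v\<in>V. (norm (T v))\<^sup>2) \<le> h"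
  by (simp add: hs_le_def)

lemma hs_le_nonneg: "hs_le T h \<Longrightarrow> 0 \<le> h"
  unfolding hs_le_def by (drule spec [of _ "{}"]) (simp add: orthonormal_def)

lemma hs_le_mono: "hs_le T h \<Longrightarrow> h \<le> h' \<Longrightarrow> hs_le T h'"
  unfolding hs_le_def by force

lemma hs_le_combine:
  assumes S: "hs_le S s" and T: "hs_le T t"
    and le: "\<And>f. norm (G f) \<le> a * norm (S f) + b * norm (T f)"
  shows "hs_le G (2 * a\<^sup>2 * s + 2 * b\<^sup>2 * t)"
  unfolding hs_le_def
proof (intro allI impI)
  fix V :: "'a sphere_L2 set" assume V: "orthonormal V"
  have "(norm (G v))\<^sup>2 \<le> 2 * a\<^sup>2 * (norm (S v))\<^sup>2 + 2 * b\<^sup>2 * (norm (T v))\<^sup>2" for v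
  proof -
    have "(norm (G v))\<^sup>2 \<le> (a * norm (S v) + b * norm (T v))\<^sup>2"
      by (intro power_mono le) auto
    also have "\<dots> \<le> 2 * (a * norm (S v))\<^sup>2 + 2 * (b * norm (T v))\<^sup>2"
      using sum_squares_bound [of "a * norm (S v)" "b * norm (T v)"] by (simp add: power2_sum)
    finally show ?thesis by (simp add: power_mult_distrib)
  qed
  then have "(\<Sum>v\<in>V. (norm (G v))\<^sup>2) \<le>
      (\<Sum>v\<in>V. 2 * a\<^sup>2 * (norm (S v))\<^sup>2 + 2 * b\<^sup>2 * (norm (T v))\<^sup>2)"
    by (intro sum_mono)
  also have "\<dots> = 2 * a\<^sup>2 * (\<Sum>v\<in>V. (norm (S v))\<^sup>2) + 2 * b\<^sup>2 * (\<Sum>v\<in>V. (norm (T v))\<^sup>2)"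
    by (simp add: sum.distrib sum_distrib_left)
  also have "\<dots> \<le> 2 * a\<^sup>2 * s + 2 * b\<^sup>2 * t"
    using hs_leD [OF S V] hs_leD [OF T V] by (intro add_mono mult_left_mono) auto
  finally show "(\<Sum>v\<in>V. (norm (G v))\<^sup>2) \<le> 2 * a\<^sup>2 * s + 2 * b\<^sup>2 * t" .
qed

section \<open>Approximation numbers of a square\<close>

lemma norm_funpow_le:
  fixes A :: "'a::real_normed_vector \<Rightarrow> 'a"
  assumes "0 \<le> c" "\<And>f. norm (A f) \<le> c * norm f"
  shows "norm ((A ^^ j) f) \<le> c ^ j * norm f"
proof (induction j)
  case (Suc j)
  have "norm ((A ^^ Suc j) f) \<le> c * norm ((A ^^ j) f)"
    using assms(2) by simp
  also have "\<dots> \<le> c * (c ^ j * norm f)"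
    using Suc assms(1) by (intro mult_left_mono)
  finally show ?case by simp
qed auto

text \<open>
  The equation for \<open>S\<close> inserted into itself \<open>k\<close> times: a truncated Neumann series, whose last term
  vanishes in the limit if \<open>A\<close> is a strict contraction.
\<close>

lemma neumann_expansion:
  assumes A: "bounded_clinear A" and eq: "\<And>f. S f = X f + A (S f)"
  shows "S f = (\<Sum>j<k. (A ^^ j) (X f)) + (A ^^ k) (S f)"
proof (induction k)
  case (Suc k)
  have "(A ^^ k) (S f) = (A ^^ k) (X f + A (S f))"
    by (rule arg_cong [OF eq])
  also have "\<dots> = (A ^^ k) (X f) + (A ^^ Suc k) (S f)"
    by (simp only: bounded_clinear_add [OF bounded_clinear_funpow [OF A]] funpow_Suc_right o_apply)
  finally show ?case
    using Suc by (simp add: add.assoc del: funpow.simps)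
qed simp

text \<open>
  Here \<open>M\<close> stands for an averaging operator.  It is not small, but it is small away from finitely
  many dimensions, while \<open>S\<close> is well approximated by \<open>M S\<close>.  The two facts together say that \<open>S\<close>
  itself is small, in the Hilbert-Schmidt sense, up to finite rank.  The constant \<open>9\<close> is \<open>2 * 2\<^sup>2\<close>, where the
  inner \<open>2\<close> is the sum of the geometric series, plus \<open>1\<close> for the last term of the expansion.
\<close>

lemma hs_split_finite_rank:
  assumes S: "bounded_clinear S" and M: "bounded_clinear M"
    and hsS: "hs_le S s" and hsM: "hs_le M \<mu>" and hsN: "hs_le (\<lambda>f. S f - M (S f)) \<delta>"
    and d: "0 < \<delta>" and r: "0 < r" "4 * \<mu> \<le> real r"
  obtains R G where "bounded_clinear R" "bounded_clinear G" "rank_le R r" "hs_le G (9 * \<delta>)"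
    "\<And>f. S f = G f + R f"
proof -
  obtain V where V: "orthonormal V" "card V \<le> r"
    and VM: "\<And>f. (norm (M (f - projection V f)))\<^sup>2 \<le> \<mu> / r * (norm f)\<^sup>2"
    using hs_finite_rank_approximation [OF M hsM r(1)] by blast
  define P where "P = projection V"
  have P: "bounded_clinear P"
    unfolding P_def using V(1) by (rule bounded_clinear_projection)
  define A where "A f = M (f - P f)" for f
  have A: "bounded_clinear A"
    unfolding A_def
    by (intro bounded_clinear_compose [OF M] bounded_clinear_minus [OF bounded_clinear_ident] P)
  have A2: "norm (A f) \<le> 1 / 2 * norm f" for f
  proof (rule power2_le_imp_le)
    have "\<mu> / r * (norm f)\<^sup>2 \<le> 1 / 4 * (norm f)\<^sup>2"
      using r by (intro mult_right_mono) (auto simp: field_simps)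
    from order_trans [OF VM this] show "(norm (A f))\<^sup>2 \<le> (1 / 2 * norm f)\<^sup>2"
      by (simp add: A_def P_def power_mult_distrib power_divide)
  qed auto
  define N where "N f = S f - M (S f)" for f
  define Q where "Q f = M (P (S f))" for f
  have N: "bounded_clinear N"
    unfolding N_def by (intro bounded_clinear_minus S bounded_clinear_compose [OF M S])
  have Q: "bounded_clinear Q"
    unfolding Q_def by (intro bounded_clinear_compose [OF M] bounded_clinear_compose [OF P] S)
  have SA: "S f = (N f + Q f) + A (S f)" for f
    by (simp add: N_def Q_def A_def bounded_clinear_diff [OF M])
  have s0: "0 \<le> s" using hsS by (rule hs_le_nonneg)
  \<comment> \<open>The last term of the expansion is negligible for large \<open>k\<close>; adding \<open>1\<close> avoids a division by zero
    if \<open>s = 0\<close>.\<close>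
  obtain k where k: "(1 / 2 :: real) ^ k < \<delta> / (2 * s + 1)"
    using real_arch_pow_inv [of "\<delta> / (2 * s + 1)" "1 / 2"] d s0 by auto
  define G where "G f = (\<Sum>j<k. (A ^^ j) (N f)) + (A ^^ k) (S f)" for f
  define R where "R f = (\<Sum>j<k. (A ^^ j) (Q f))" for f
  have sumA: "bounded_clinear (\<lambda>f. \<Sum>j<k. (A ^^ j) f)"
    by (intro bounded_clinear_sum bounded_clinear_funpow A)
  show ?thesis
  proof (rule that)
    show "bounded_clinear R"
      unfolding R_def by (rule bounded_clinear_compose [OF sumA Q])
    show "bounded_clinear G"
      unfolding G_def
      by (intro bounded_clinear_plus bounded_clinear_compose [OF sumA N]
          bounded_clinear_compose [OF bounded_clinear_funpow [OF A] S])
    have "rank_le P r"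
      unfolding P_def by (rule rank_le_mono [OF rank_le_projection [OF V(1)] V(2)])
    then have "rank_le (\<lambda>f. P (S f)) r"
      by (rule rank_le_precompose)
    then have "rank_le Q r"
      unfolding Q_def by (rule rank_le_postcompose [OF M])
    then show "rank_le R r"
      unfolding R_def by (rule rank_le_postcompose [OF sumA])
    show "S f = G f + R f" for f
    proof -
      have "S f = (\<Sum>j<k. (A ^^ j) (N f + Q f)) + (A ^^ k) (S f)"
        using A SA by (rule neumann_expansion)
      also have "\<dots> = G f + R f"
        by (simp add: G_def R_def bounded_clinear_add [OF bounded_clinear_funpow [OF A]] sum.distrib)
      finally show ?thesis .
    qed
    have "norm (G f) \<le> 2 * norm (N f) + (1 / 2) ^ k * norm (S f)" for f
    proof -
      have "norm (\<Sum>j<k. (A ^^ j) (N f)) \<le> (\<Sum>j<k. (1 / 2) ^ j * norm (N f))"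
        by (intro sum_norm_le norm_funpow_le) (auto simp: A2 [simplified])
      also have "\<dots> = (\<Sum>j<k. (1 / 2) ^ j) * norm (N f)"
        by (simp add: sum_distrib_right)
      also have "\<dots> \<le> 2 * norm (N f)"
        by (intro mult_right_mono) (simp_all add: sum_gp_strict)
      finally have 1: "norm (\<Sum>j<k. (A ^^ j) (N f)) \<le> 2 * norm (N f)" .
      have 2: "norm ((A ^^ k) (S f)) \<le> (1 / 2) ^ k * norm (S f)"
        by (intro norm_funpow_le) (auto simp: A2 [simplified])
      show ?thesis
        unfolding G_def by (rule order_trans [OF norm_triangle_ineq add_mono [OF 1 2]])
    qed
    then have "hs_le G (2 * 2\<^sup>2 * \<delta> + 2 * ((1 / 2) ^ k)\<^sup>2 * s)"
      by (rule hs_le_combine [OF hsN [folded N_def] hsS])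
    moreover have "2 * ((1 / 2) ^ k)\<^sup>2 * s \<le> \<delta>"
    proof -
      have "((1 / 2 :: real) ^ k)\<^sup>2 \<le> (1 / 2) ^ k * 1"
        unfolding power2_eq_square by (intro mult_left_mono power_le_one) auto
      from mult_right_mono [OF this, of "2 * s"]
      have "2 * ((1 / 2) ^ k)\<^sup>2 * s \<le> (1 / 2) ^ k * (2 * s)"
        using s0 by (simp add: mult_ac)
      also have "\<dots> \<le> \<delta> / (2 * s + 1) * (2 * s + 1)"
        using k s0 d by (intro mult_mono) auto
      also have "\<dots> = \<delta>" using s0 by auto
      finally show ?thesis .
    qed
    ultimately show "hs_le G (9 * \<delta>)"
      by (elim hs_le_mono) simp
  qed
qed

text \<open>
  A Hilbert-Schmidt bound \<open>9 \<delta>\<close> for \<open>S\<close> up to rank \<open>r\<close> becomes, after \<open>r\<close> more dimensions are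
  removed, a bound \<open>9 \<delta> / r\<close> for the square of the operator norm.  This square is the norm bound for
  \<open>S S\<close>; here the approximation numbers gain the additional factor \<open>1 / r\<close>.
\<close>

lemma approx_number_square_le:
  assumes S: "bounded_clinear S" and M: "bounded_clinear M"
    and hsS: "hs_le S s" and hsM: "hs_le M \<mu>" and hsN: "hs_le (\<lambda>f. S f - M (S f)) \<delta>"
    and d: "0 < \<delta>" and r: "0 < r" "4 * \<mu> \<le> real r" and n: "4 * r < n"
    and T: "\<And>f. T f = S (S f)"
  shows "approx_number n T \<le> 9 * \<delta> / r"
proof -
  obtain R G where R: "bounded_clinear R" "rank_le R r"
    and G: "bounded_clinear G" "hs_le G (9 * \<delta>)" and SGR: "\<And>f. S f = G f + R f"
    using hs_split_finite_rank [OF S M hsS hsM hsN d r] by blast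
  obtain V where V: "orthonormal V" "card V \<le> r"
    and VG: "\<And>f. (norm (G (f - projection V f)))\<^sup>2 \<le> 9 * \<delta> / r * (norm f)\<^sup>2"
    using hs_finite_rank_approximation [OF G r(1)] by blast
  define P where "P = projection V"
  have P: "bounded_clinear P" "rank_le P r"
    unfolding P_def using V
    by (auto intro: bounded_clinear_projection rank_le_mono [OF rank_le_projection])
  define E where "E f = G (f - P f)" for f
  define U where "U f = R f + G (P f)" for f
  have E: "bounded_clinear E"
    unfolding E_def
    by (intro bounded_clinear_compose [OF G(1)] bounded_clinear_minus [OF bounded_clinear_ident] P(1))
  have U: "bounded_clinear U"
    unfolding U_def by (intro bounded_clinear_plus R bounded_clinear_compose [OF G(1) P(1)])
  have rU: "rank_le U (r + r)"
    unfolding U_def by (intro rank_le_add R rank_le_postcompose [OF G(1)] P)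
  have SU: "S f = U f + E f" for f
    by (simp add: SGR U_def E_def bounded_clinear_diff [OF G(1)])
  \<comment> \<open>\<open>S S = S U + S E = S U + U E + E E\<close>\<close>
  define W where "W f = S (U f) + U (E f)" for f
  have W: "bounded_clinear W"
    unfolding W_def by (intro bounded_clinear_plus bounded_clinear_compose [OF S U]
        bounded_clinear_compose [OF U E])
  have "rank_le W ((r + r) + (r + r))"
    unfolding W_def by (rule rank_le_add [OF rank_le_postcompose [OF S rU] rank_le_precompose [OF rU]])
  then have rW: "rank_le W (n - 1)"
    by (rule rank_le_mono) (use n in simp)
  have TW: "T f - W f = E (E f)" for f
  proof -
    have "T f = S (U f + E f)" by (simp only: T SU [of f])
    also have "\<dots> = S (U f) + (U (E f) + E (E f))"
      by (simp only: bounded_clinear_add [OF S] SU [of "E f"])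
    finally show ?thesis by (simp add: W_def)
  qed
  define c where "c = 9 * \<delta> / r"
  have c: "0 < c" using d r by (simp add: c_def)
  have En: "norm (E f) \<le> sqrt c * norm f" for f
  proof (rule power2_le_imp_le)
    show "(norm (E f))\<^sup>2 \<le> (sqrt c * norm f)\<^sup>2"
      using VG [of f] c by (simp add: E_def P_def power_mult_distrib c_def)
  qed (use c in simp)
  have "norm (T f - W f) \<le> c * norm f" for f
  proof -
    have "norm (E (E f)) \<le> sqrt c * (sqrt c * norm f)"
      using c by (intro order_trans [OF En] mult_left_mono En) auto
    also have "\<dots> = c * norm f"
      using c by (simp flip: mult.assoc)
    finally show ?thesis by (simp add: TW)
  qed
  moreover have "T = (\<lambda>f. S (S f))" using T by blast
  then have "bounded_clinear T" by (simp add: bounded_clinear_compose [OF S S])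
  ultimately show ?thesis
    using approx_number_le [OF W rW, of T c] c by (simp add: c_def)
qed

section \<open>Operators generated by square integrable kernels\<close>

abbreviation (input) \<sigma> :: "'a::euclidean_space measure" where "\<sigma> \<equiv> sphere_measure"

lemma sphere_L2_eqI:
  assumes "AE x in \<sigma>. rep_sphere_L2 f x = rep_sphere_L2 g x"
  shows "f = g"
proof -
  have "L2_eq (rep_sphere_L2 f) (rep_sphere_L2 g)"
    using assms by (simp add: L2_eq_def rep_sphere_L2_in)
  then show ?thesis
    using Quotient3_rel_rep [OF Quotient3_sphere_L2] by blast
qed

lemma rep_sphere_L2_add: "AE x in \<sigma>. rep_sphere_L2 (f + g) x = rep_sphere_L2 f x + rep_sphere_L2 g x"
  unfolding plus_sphere_L2_def map_fun_def o_def
  by (intro rep_abs_sphere_L2 L2_fun_add rep_sphere_L2_in)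

lemma rep_sphere_L2_scaleC: "AE x in \<sigma>. rep_sphere_L2 (scaleC c f) x = c * rep_sphere_L2 f x"
  unfolding scaleC_def map_fun_def o_def id_def
  by (intro rep_abs_sphere_L2 L2_fun_scale rep_sphere_L2_in)

lemma rep_sphere_L2_diff: "AE x in \<sigma>. rep_sphere_L2 (f - g) x = rep_sphere_L2 f x - rep_sphere_L2 g x"
  using rep_sphere_L2_add [of "f - g" g] by (auto elim: eventually_mono)

lemma cinner_eq_integral: "cinner f g = (LINT x|\<sigma>. rep_sphere_L2 f x * cnj (rep_sphere_L2 g x))"
  by (simp add: cinner_def)

lemma norm_sphere_L2_eq_integral: "(norm f)\<^sup>2 = (LINT x|\<sigma>. (cmod (rep_sphere_L2 f x))\<^sup>2)"
proof -
  have "complex_of_real ((norm f)\<^sup>2) = complex_of_real (LINT x|\<sigma>. (cmod (rep_sphere_L2 f x))\<^sup>2)"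
    by (simp only: cinner_self [symmetric] cinner_eq_integral cinner_self_Re)
  then show ?thesis by (simp only: of_real_eq_iff)
qed

text \<open>
  Bessel's inequality for the class of the conjugate of \<open>k\<close>, stated for the integrals that occur when
  an integral operator acts on \<open>V\<close>.
\<close>

lemma bessel_function:
  assumes V: "orthonormal V" and k: "k \<in> L2_fun \<sigma>"
  shows "(\<Sum>v\<in>V. (cmod (LINT y|\<sigma>. k y * rep_sphere_L2 v y))\<^sup>2) \<le> (LINT y|\<sigma>. (cmod (k y))\<^sup>2)"
proof -
  define \<kappa> where "\<kappa> = abs_sphere_L2 (\<lambda>y. cnj (k y))"
  have \<kappa>: "AE y in \<sigma>. rep_sphere_L2 \<kappa> y = cnj (k y)"
    unfolding \<kappa>_def by (intro rep_abs_sphere_L2 L2_fun_cnj k)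
  have "(LINT y|\<sigma>. k y * rep_sphere_L2 v y) = cinner v \<kappa>" for v
    unfolding cinner_eq_integral
  proof (rule integral_cong_AE)
    show "(\<lambda>y. k y * rep_sphere_L2 v y) \<in> borel_measurable \<sigma>"
      by (intro borel_measurable_integrable L2_fun_integrable_mult k rep_sphere_L2_in)
    show "(\<lambda>y. rep_sphere_L2 v y * cnj (rep_sphere_L2 \<kappa> y)) \<in> borel_measurable \<sigma>"
      by (intro borel_measurable_integrable L2_fun_integrable_mult L2_fun_cnj rep_sphere_L2_in)
    show "AE y in \<sigma>. k y * rep_sphere_L2 v y = rep_sphere_L2 v y * cnj (rep_sphere_L2 \<kappa> y)"
      using \<kappa> by eventually_elim simp
  qed
  moreover have "(norm \<kappa>)\<^sup>2 = (LINT y|\<sigma>. (cmod (k y))\<^sup>2)"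
    unfolding norm_sphere_L2_eq_integral
  proof (rule integral_cong_AE)
    show "(\<lambda>y. (cmod (rep_sphere_L2 \<kappa> y))\<^sup>2) \<in> borel_measurable \<sigma>"
      using L2_funD(2) [OF rep_sphere_L2_in] by (rule borel_measurable_integrable)
    show "(\<lambda>y. (cmod (k y))\<^sup>2) \<in> borel_measurable \<sigma>"
      using L2_funD(2) [OF k] by (rule borel_measurable_integrable)
    show "AE y in \<sigma>. (cmod (rep_sphere_L2 \<kappa> y))\<^sup>2 = (cmod (k y))\<^sup>2"
      using \<kappa> by eventually_elim simp
  qed
  ultimately show ?thesis
    using bessel [OF V, of \<kappa>] by (simp add: cinner_commute [of \<kappa>])
qed

text \<open>
  Bessel's inequality is applied to each row of the kernel and then integrated.  The row norms are
  only bounded by an integrable \<open>g\<close>, because for the difference of \<open>S\<close> and its average only such a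
  bound is available.
\<close>

lemma hs_le_kernel:
  assumes T: "generated_by_kernel T k" and g: "integrable \<sigma> g"
    and k: "AE x in \<sigma>. k x \<in> L2_fun \<sigma> \<and> (LINT y|\<sigma>. (cmod (k x y))\<^sup>2) \<le> g x"
  shows "hs_le T (LINT x|\<sigma>. g x)"
  unfolding hs_le_def
proof (intro allI impI)
  fix V :: "'a sphere_L2 set" assume V: "orthonormal V"
  then have fin: "finite V" by (simp add: orthonormal_def)
  have int: "integrable \<sigma> (\<lambda>x. (cmod (rep_sphere_L2 (T v) x))\<^sup>2)" for v
    by (rule L2_funD(2) [OF rep_sphere_L2_in])
  have "AE x in \<sigma>. \<forall>v\<in>V. has_bochner_integral \<sigma> (\<lambda>y. k x y * rep_sphere_L2 v y) (rep_sphere_L2 (T v) x)"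
    using T fin unfolding generated_by_kernel_def by (intro AE_finite_allI) auto
  with k have AE: "AE x in \<sigma>. (\<Sum>v\<in>V. (cmod (rep_sphere_L2 (T v) x))\<^sup>2) \<le> g x"
  proof eventually_elim
    fix x
    assume kx: "k x \<in> L2_fun \<sigma> \<and> (LINT y|\<sigma>. (cmod (k x y))\<^sup>2) \<le> g x"
      and "\<forall>v\<in>V. has_bochner_integral \<sigma> (\<lambda>y. k x y * rep_sphere_L2 v y) (rep_sphere_L2 (T v) x)"
    then have "(\<Sum>v\<in>V. (cmod (rep_sphere_L2 (T v) x))\<^sup>2) =
        (\<Sum>v\<in>V. (cmod (LINT y|\<sigma>. k x y * rep_sphere_L2 v y))\<^sup>2)"
      by (intro sum.cong) (auto simp: has_bochner_integral_iff)
    also have "\<dots> \<le> g x"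
      using bessel_function [OF V] kx by (meson order_trans)
    finally show "(\<Sum>v\<in>V. (cmod (rep_sphere_L2 (T v) x))\<^sup>2) \<le> g x" .
  qed
  have "(\<Sum>v\<in>V. (norm (T v))\<^sup>2) = (LINT x|\<sigma>. (\<Sum>v\<in>V. (cmod (rep_sphere_L2 (T v) x))\<^sup>2))"
    unfolding norm_sphere_L2_eq_integral by (rule Bochner_Integration.integral_sum [symmetric]) (rule int)
  also have "\<dots> \<le> (LINT x|\<sigma>. g x)"
    using g AE by (intro integral_mono_AE Bochner_Integration.integrable_sum int)
  finally show "(\<Sum>v\<in>V. (norm (T v))\<^sup>2) \<le> (LINT x|\<sigma>. g x)" .
qed

lemma generated_by_kernel_add:
  assumes T: "generated_by_kernel T k"
  shows "T (f + g) = T f + T g"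
proof (rule sphere_L2_eqI)
  have *: "AE x in \<sigma>. has_bochner_integral \<sigma> (\<lambda>y. k x y * rep_sphere_L2 h y) (rep_sphere_L2 (T h) x)" for h
    using T by (simp add: generated_by_kernel_def)
  show "AE x in \<sigma>. rep_sphere_L2 (T (f + g)) x = rep_sphere_L2 (T f + T g) x"
    using * [of f] * [of g] * [of "f + g"] rep_sphere_L2_add [of "T f" "T g"]
  proof eventually_elim
    case (elim x)
    have "(LINT y|\<sigma>. k x y * rep_sphere_L2 (f + g) y) =
        (LINT y|\<sigma>. k x y * rep_sphere_L2 f y + k x y * rep_sphere_L2 g y)"
      using elim rep_sphere_L2_add [of f g]
      by (intro integral_cong_AE) (auto simp: has_bochner_integral_iff distrib_left)
    with elim show ?case by (simp add: has_bochner_integral_iff)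
  qed
qed

lemma generated_by_kernel_scaleC:
  assumes T: "generated_by_kernel T k"
  shows "T (scaleC c f) = scaleC c (T f)"
proof (rule sphere_L2_eqI)
  have *: "AE x in \<sigma>. has_bochner_integral \<sigma> (\<lambda>y. k x y * rep_sphere_L2 h y) (rep_sphere_L2 (T h) x)" for h
    using T by (simp add: generated_by_kernel_def)
  show "AE x in \<sigma>. rep_sphere_L2 (T (scaleC c f)) x = rep_sphere_L2 (scaleC c (T f)) x"
    using * [of f] * [of "scaleC c f"] rep_sphere_L2_scaleC [of c "T f"]
  proof eventually_elim
    case (elim x)
    have "(LINT y|\<sigma>. k x y * rep_sphere_L2 (scaleC c f) y) =
        (LINT y|\<sigma>. c * (k x y * rep_sphere_L2 f y))"
      using elim rep_sphere_L2_scaleC [of c f]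
      by (intro integral_cong_AE) (auto simp: has_bochner_integral_iff mult_ac elim: eventually_mono)
    with elim show ?case by (simp add: has_bochner_integral_iff)
  qed
qed

lemma bounded_clinear_if_hs_le:
  assumes add: "\<And>f g. T (f + g) = T f + T g" and scale: "\<And>c f. T (scaleC c f) = scaleC c (T f)"
    and hs: "hs_le T h"
  shows "bounded_clinear T"
proof (rule bounded_clinearI [where C = "sqrt h", OF add scale])
  fix f
  show "norm (T f) \<le> sqrt h * norm f"
  proof (cases "f = 0")
    case True
    then show ?thesis using scale [of 0 0] by simp
  next
    case False
    define u where "u = scaleC (1 / norm f) f"
    have "orthonormal {u}"
      using False unfolding u_def orthonormal_def
      by (simp add: cinner_self norm_scaleC norm_divide)
    from hs_leD [OF hs this] have "norm (T u) \<le> sqrt h"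
      by (simp add: real_le_rsqrt)
    moreover have "norm (T u) = norm (T f) / norm f"
      unfolding u_def scale norm_scaleC by (simp add: norm_divide)
    ultimately show ?thesis using False by (simp add: field_simps)
  qed
qed

lemma pair_sigma_finite_sphere_measure: "pair_sigma_finite (\<sigma> :: 'a::euclidean_space measure) (\<sigma> :: 'a measure)"
proof -
  interpret finite_measure "\<sigma> :: 'a measure" by (rule finite_measure_sphere_measure)
  interpret pair_sigma_finite "\<sigma> :: 'a measure" "\<sigma> :: 'a measure" ..
  show ?thesis by (rule pair_sigma_finite_axioms)
qed

lemma L2_kernel_sections:
  fixes k :: "'a::euclidean_space \<Rightarrow> 'a \<Rightarrow> complex"
  assumes k: "case_prod k \<in> L2_fun (\<sigma> \<Otimes>\<^sub>M \<sigma>)"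
  shows "AE x in \<sigma>. k x \<in> L2_fun \<sigma>" "integrable \<sigma> (\<lambda>x. LINT y|\<sigma>. (cmod (k x y))\<^sup>2)"
proof -
  interpret P: pair_sigma_finite "\<sigma> :: 'a measure" "\<sigma> :: 'a measure" by (rule pair_sigma_finite_sphere_measure)
  have int: "integrable (\<sigma> \<Otimes>\<^sub>M \<sigma>) (\<lambda>(x, y). (cmod (k x y))\<^sup>2)"
    using L2_funD(2) [OF k] by (simp add: case_prod_unfold)
  show "AE x in \<sigma>. k x \<in> L2_fun \<sigma>"
    using AE_space P.AE_integrable_fst [OF int]
  proof eventually_elim
    case (elim x)
    then show ?case
      using measurable_Pair2 [OF L2_funD(1) [OF k]] by (simp add: L2_fun_def)
  qed
  show "integrable \<sigma> (\<lambda>x. LINT y|\<sigma>. (cmod (k x y))\<^sup>2)"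
    using P.integrable_fst [OF int] by simp
qed

lemma hs_le_L2_kernel:
  assumes "generated_by_kernel T k" "case_prod k \<in> L2_fun (\<sigma> \<Otimes>\<^sub>M \<sigma>)"
  shows "hs_le T (LINT x|\<sigma>. LINT y|\<sigma>. (cmod (k x y))\<^sup>2)"
  using assms L2_kernel_sections [OF assms(2)] by (intro hs_le_kernel) auto

lemma bounded_clinear_L2_kernel:
  assumes "generated_by_kernel T k" "case_prod k \<in> L2_fun (\<sigma> \<Otimes>\<^sub>M \<sigma>)"
  shows "bounded_clinear T"
  using generated_by_kernel_add [OF assms(1)] generated_by_kernel_scaleC [OF assms(1)]
    hs_le_L2_kernel [OF assms] by (rule bounded_clinear_if_hs_le)

lemma generated_by_kernel_diff:
  assumes S: "generated_by_kernel S k" and T: "generated_by_kernel T l"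
  shows "generated_by_kernel (\<lambda>f. S f - T f) (\<lambda>x y. k x y - l x y)"
  unfolding generated_by_kernel_def
proof (intro conjI allI)
  show "(\<lambda>(x, y). k x y - l x y) \<in> borel_measurable (\<sigma> \<Otimes>\<^sub>M \<sigma>)"
    using S T unfolding generated_by_kernel_def case_prod_unfold by (intro borel_measurable_diff) auto
next
  fix f
  have "AE x in \<sigma>. has_bochner_integral \<sigma> (\<lambda>y. k x y * rep_sphere_L2 f y) (rep_sphere_L2 (S f) x)"
    "AE x in \<sigma>. has_bochner_integral \<sigma> (\<lambda>y. l x y * rep_sphere_L2 f y) (rep_sphere_L2 (T f) x)"
    using S T by (simp_all add: generated_by_kernel_def)
  then show "AE x in \<sigma>. has_bochner_integral \<sigma> (\<lambda>y. (k x y - l x y) * rep_sphere_L2 f y)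
      (rep_sphere_L2 (S f - T f) x)"
    using rep_sphere_L2_diff [of "S f" "T f"]
    by eventually_elim (auto simp: left_diff_distrib intro!: has_bochner_integral_diff)
qed

lemma L2_fun_tensor:
  fixes f g :: "'a::euclidean_space \<Rightarrow> complex"
  assumes f: "f \<in> L2_fun \<sigma>" and g: "g \<in> L2_fun \<sigma>"
  shows "(\<lambda>(x, y). f x * g y) \<in> L2_fun (\<sigma> \<Otimes>\<^sub>M \<sigma>)"
proof -
  interpret P: pair_sigma_finite "\<sigma> :: 'a measure" "\<sigma> :: 'a measure" by (rule pair_sigma_finite_sphere_measure)
  have [measurable]: "f \<in> borel_measurable \<sigma>" "g \<in> borel_measurable \<sigma>"
    using f g by (auto dest: L2_funD)
  have "integrable (\<sigma> \<Otimes>\<^sub>M \<sigma>) (\<lambda>(x, y). (cmod (f x))\<^sup>2 * (cmod (g y))\<^sup>2)"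
    using L2_funD(2) [OF f] L2_funD(2) [OF g] by (intro P.Fubini_integrable) auto
  then show ?thesis
    by (simp add: L2_fun_def case_prod_unfold norm_mult power_mult_distrib)
qed

text \<open>
  For almost every \<open>x\<close> the integrand \<open>k x w * l w y * f y\<close> is a product of two square integrable
  functions of \<open>(w, y)\<close>, so Fubini's theorem applies.
\<close>

lemma generated_by_kernel_compose:
  fixes k l :: "'a::euclidean_space \<Rightarrow> 'a \<Rightarrow> complex"
  assumes S: "generated_by_kernel S k" and k: "case_prod k \<in> L2_fun (\<sigma> \<Otimes>\<^sub>M \<sigma>)"
    and T: "generated_by_kernel T l" and l: "case_prod l \<in> L2_fun (\<sigma> \<Otimes>\<^sub>M \<sigma>)"
  shows "generated_by_kernel (\<lambda>f. S (T f)) (\<lambda>x y. LINT w|\<sigma>. k x w * l w y)"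
  unfolding generated_by_kernel_def
proof (intro conjI allI)
  interpret P: pair_sigma_finite "\<sigma> :: 'a measure" "\<sigma> :: 'a measure" by (rule pair_sigma_finite_sphere_measure)
  note [measurable] = L2_funD(1) [OF k] L2_funD(1) [OF l]
  have "(\<lambda>(p, w). k (fst p) w * l w (snd p)) \<in> borel_measurable ((\<sigma> \<Otimes>\<^sub>M \<sigma>) \<Otimes>\<^sub>M \<sigma>)"
    by measurable
  from P.M1.borel_measurable_lebesgue_integral [OF this]
  show "(\<lambda>(x, y). LINT w|\<sigma>. k x w * l w y) \<in> borel_measurable (\<sigma> \<Otimes>\<^sub>M \<sigma>)"
    by (simp add: case_prod_unfold)
  fix f
  have "AE x in \<sigma>. has_bochner_integral \<sigma> (\<lambda>w. k x w * rep_sphere_L2 (T f) w) (rep_sphere_L2 (S (T f)) x)"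
    using S by (simp add: generated_by_kernel_def)
  then show "AE x in \<sigma>. has_bochner_integral \<sigma> (\<lambda>y. (LINT w|\<sigma>. k x w * l w y) * rep_sphere_L2 f y)
      (rep_sphere_L2 (S (T f)) x)"
    using L2_kernel_sections(1) [OF k]
  proof eventually_elim
    case (elim x)
    have "integrable (\<sigma> \<Otimes>\<^sub>M \<sigma>) (\<lambda>p. case_prod l p * (\<lambda>(w, y). k x w * rep_sphere_L2 f y) p)"
      by (intro L2_fun_integrable_mult l L2_fun_tensor elim rep_sphere_L2_in)
    then have int: "integrable (\<sigma> \<Otimes>\<^sub>M \<sigma>) (\<lambda>(w, y). k x w * l w y * rep_sphere_L2 f y)"
      by (simp add: case_prod_unfold mult_ac)
    have 1: "integrable \<sigma> (\<lambda>y. (LINT w|\<sigma>. k x w * l w y) * rep_sphere_L2 f y)"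
      using P.integrable_snd [OF int] by simp
    have "AE w in \<sigma>. (LINT y|\<sigma>. k x w * l w y * rep_sphere_L2 f y) = k x w * rep_sphere_L2 (T f) w"
    proof -
      have "AE w in \<sigma>. has_bochner_integral \<sigma> (\<lambda>y. l w y * rep_sphere_L2 f y) (rep_sphere_L2 (T f) w)"
        using T by (simp add: generated_by_kernel_def)
      then show ?thesis
        by eventually_elim (auto simp: has_bochner_integral_iff mult.assoc)
    qed
    then have "(LINT w|\<sigma>. LINT y|\<sigma>. k x w * l w y * rep_sphere_L2 f y) =
        (LINT w|\<sigma>. k x w * rep_sphere_L2 (T f) w)"
      using elim P.integrable_fst [OF int]
      by (intro integral_cong_AE) (auto simp: has_bochner_integral_iff)
    moreover have "(LINT y|\<sigma>. LINT w|\<sigma>. k x w * l w y * rep_sphere_L2 f y) =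
        (LINT w|\<sigma>. LINT y|\<sigma>. k x w * l w y * rep_sphere_L2 f y)"
      by (rule P.Fubini_integral [OF int])
    ultimately show ?case
      using 1 elim by (simp add: has_bochner_integral_iff)
  qed
qed

section \<open>The measure of spherical caps\<close>

lemma one_minus_cos_le: "1 - cos t \<le> t\<^sup>2 / 2" for t :: real
proof -
  have "(sin (t / 2))\<^sup>2 \<le> (t / 2)\<^sup>2"
    using abs_sin_x_le_abs_x [of "t / 2"] by (simp only: abs_le_square_iff)
  then show ?thesis
    using cos_double_sin [of "t / 2"] by (simp add: power_divide)
qed

lemma one_minus_cos_ge:
  fixes t :: real
  assumes "0 \<le> t" "t \<le> 1"
  shows "t\<^sup>2 / 8 \<le> 1 - cos t"
proof -
  have "sin 0 - 0 / 2 \<le> sin (t / 2) - (t / 2) / 2"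
  proof (rule DERIV_nonneg_imp_nondecreasing [of 0 "t / 2" "\<lambda>u. sin u - u / 2"])
    fix u :: real assume u: "0 \<le> u" "u \<le> t / 2"
    have "cos (pi / 3) \<le> cos u"
      using u assms pi_gt3 by (intro cos_monotone_0_pi_le) auto
    then have "0 \<le> cos u - 1 / 2" by (simp add: cos_60)
    moreover have "((\<lambda>u. sin u - u / 2) has_real_derivative cos u - 1 / 2) (at u)"
      by (auto intro!: derivative_eq_intros)
    ultimately show "\<exists>y. ((\<lambda>u. sin u - u / 2) has_real_derivative y) (at u) \<and> 0 \<le> y"
      by blast
  qed (use assms in simp)
  then have "(t / 4)\<^sup>2 \<le> (sin (t / 2))\<^sup>2"
    using assms by (intro power_mono) auto
  then show ?thesis
    using cos_double_sin [of "t / 2"] by (simp add: power_divide)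
qed

lemma cap_sets [measurable]: "cap t x \<in> sets \<sigma>"
proof -
  have "cap t x = sphere 0 1 \<inter> {y. cos t \<le> x \<bullet> y}"
    by (auto simp: cap_def)
  moreover have "{y. cos t \<le> x \<bullet> y} \<in> sets borel"
    by measurable
  ultimately show ?thesis
    by (auto simp: sets_sphere_measure sets_restrict_space)
qed

text \<open>
  The part of the unit ball over a spherical cap: the cone in the definition of the surface measure,
  written without reference to its generators so that it is visibly a Borel set.
\<close>

definition solid_cap :: "real \<Rightarrow> 'a::euclidean_space \<Rightarrow> 'a set" where
  "solid_cap t x = {z. z \<noteq> 0 \<and> norm z \<le> 1 \<and> cos t * norm z \<le> x \<bullet> z}"

lemma solid_cap_sets [measurable]: "solid_cap t x \<in> sets borel"
  unfolding solid_cap_def by measurable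

lemma solid_cap_fmeasurable: "solid_cap t (x :: 'a::euclidean_space) \<in> fmeasurable lborel"
proof (rule fmeasurableI)
  have "emeasure lborel (solid_cap t x) \<le> emeasure lborel (cball (0::'a) 1)"
    by (intro emeasure_mono) (auto simp: solid_cap_def)
  also have "\<dots> < \<infinity>" by (rule emeasure_lborel_cball_finite)
  finally show "emeasure lborel (solid_cap t x) < \<infinity>" .
qed simp

lemma measure_cap:
  "measure \<sigma> (cap t (x :: 'a::euclidean_space)) = DIM('a) * measure lborel (solid_cap t x)"
proof -
  have eq: "{r *\<^sub>R y | r y. 0 < r \<and> r \<le> 1 \<and> y \<in> cap t x} = solid_cap t x"
  proof (intro set_eqI iffI)
    fix z assume "z \<in> {r *\<^sub>R y | r y. 0 < r \<and> r \<le> 1 \<and> y \<in> cap t x}"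
    then obtain r y where "z = r *\<^sub>R y" "0 < r" "r \<le> 1" "norm y = 1" "cos t \<le> x \<bullet> y"
      by (auto simp: cap_def)
    then show "z \<in> solid_cap t x"
      by (auto simp: solid_cap_def mult.commute)
  next
    fix z assume z: "z \<in> solid_cap t x"
    then have "z = norm z *\<^sub>R (z /\<^sub>R norm z)" "0 < norm z" "norm z \<le> 1" "z /\<^sub>R norm z \<in> cap t x"
      by (auto simp: solid_cap_def cap_def field_simps)
    then show "z \<in> {r *\<^sub>R y | r y. 0 < r \<and> r \<le> 1 \<and> y \<in> cap t x}" by blast
  qed
  have "emeasure \<sigma> (cap t x) = of_nat DIM('a) * emeasure lborel (solid_cap t x)"
    using emeasure_sphere_measure [of "cap t x"] cap_sets [of t x] unfolding eq sets_sphere_measure by simp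
  then show ?thesis
    by (simp add: measure_def enn2real_mult)
qed

lemma norm_diff_scaleR_square:
  fixes x z :: "'a::real_inner"
  assumes "norm x = 1"
  shows "(norm (z - a *\<^sub>R x))\<^sup>2 = (norm z)\<^sup>2 + a\<^sup>2 - 2 * a * (x \<bullet> z)"
  using assms unfolding power2_norm_eq_inner norm_eq_1
  by (simp add: algebra_simps inner_commute power2_eq_square)

text \<open>
  The part of the unit ball over the cap contains about \<open>1 / t\<close> disjoint balls of radius \<open>t / 8\<close> with
  centres on the ray through \<open>x\<close> at distance at least \<open>1/2\<close> from the origin.  Each of them has volume of
  order \<open>t ^ DIM('a)\<close>, so one power of \<open>t\<close> is lost.
\<close>

lemma measure_cap_ge:
  fixes x :: "'a::euclidean_space"
  assumes x: "norm x = 1" and t: "0 < t" "t \<le> 1"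
  shows "DIM('a) * unit_ball_vol DIM('a) / 8 ^ DIM('a) * t ^ (DIM('a) - 1) \<le> measure \<sigma> (cap t x)"
proof -
  \<comment> \<open>The largest number for which all balls stay inside the unit ball.\<close>
  define N where "N = nat \<lfloor>2 / t\<rfloor>"
  define c where "c j = (1 / 2 + (2 * real j + 1) * (t / 8))" for j :: nat
  have N: "1 / t \<le> real N" "real N \<le> 2 / t"
  proof -
    have "1 \<le> 1 / t" using t by simp
    then show "1 / t \<le> real N"
      unfolding N_def by linarith
    show "real N \<le> 2 / t"
      unfolding N_def using t by simp
  qed
  have ball: "ball (c j *\<^sub>R x) (t / 8) \<subseteq> solid_cap t x" if j: "j < N" for j
  proof
    fix z assume "z \<in> ball (c j *\<^sub>R x) (t / 8)"
    then have z: "norm (z - c j *\<^sub>R x) < t / 8"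
      by (simp add: dist_norm norm_minus_commute)
    have c1: "1 / 2 + t / 8 \<le> c j" using t by (simp add: c_def)
    have "2 * real j + 2 \<le> 4 / t" using j N(2) by linarith
    then have "(2 * real j + 2) * t \<le> 4" using t by (simp add: pos_le_divide_eq)
    then have c2: "c j + t / 8 \<le> 1" by (simp add: c_def field_simps)
    have nc: "norm (c j *\<^sub>R x) = c j" using x c1 t by simp
    have s: "1 / 2 \<le> norm z" "norm z \<le> 1"
      using norm_triangle_ineq2 [of "c j *\<^sub>R x" z] norm_triangle_ineq2 [of z "c j *\<^sub>R x"] z c1 c2
      unfolding nc norm_minus_commute [of "c j *\<^sub>R x"] by linarith+
    have "(norm (z - c j *\<^sub>R x))\<^sup>2 \<le> (t / 8)\<^sup>2"
      using z by (intro power_mono) auto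
    also have "(t / 8)\<^sup>2 \<le> 1 / 2 * (t\<^sup>2 / 8)"
      by (simp add: power_divide)
    also have "\<dots> \<le> (2 * norm z * c j) * (1 - cos t)"
    proof (rule mult_mono)
      show "1 / 2 \<le> 2 * norm z * c j"
        using mult_mono [of "1 / 2" "norm z" "1 / 2" "c j"] s c1 t by simp
    qed (use one_minus_cos_ge t s c1 in auto)
    also have "\<dots> \<le> (2 * norm z * c j) * (1 - cos t) + (norm z - c j)\<^sup>2"
      by simp
    finally have "(norm (z - c j *\<^sub>R x))\<^sup>2 \<le> (norm z)\<^sup>2 + (c j)\<^sup>2 - 2 * c j * (cos t * norm z)"
      by (simp add: algebra_simps power2_eq_square)
    moreover have "(norm (z - c j *\<^sub>R x))\<^sup>2 = (norm z)\<^sup>2 + (c j)\<^sup>2 - 2 * c j * (x \<bullet> z)"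
      by (rule norm_diff_scaleR_square [OF x])
    ultimately have "2 * c j * (cos t * norm z) \<le> 2 * c j * (x \<bullet> z)"
      by linarith
    moreover have "0 < 2 * c j" using c1 t by simp
    ultimately have "cos t * norm z \<le> x \<bullet> z"
      by (simp only: mult_le_cancel_left_pos)
    with s show "z \<in> solid_cap t x" by (auto simp: solid_cap_def)
  qed
  have disj: "pairwise (\<lambda>i j. disjnt (ball (c i *\<^sub>R x) (t / 8)) (ball (c j *\<^sub>R x) (t / 8))) {..<N}"
  proof (intro pairwiseI)
    fix i j :: nat assume "i \<noteq> j"
    then have "1 \<le> \<bar>real i - real j\<bar>" by linarith
    then have "2 * (t / 8) \<le> \<bar>real i - real j\<bar> * (2 * (t / 8))"
      using t by simp
    also have "\<dots> = dist (c i *\<^sub>R x) (c j *\<^sub>R x)"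
    proof -
      have "c i - c j = (real i - real j) * (2 * (t / 8))"
        by (simp add: c_def field_simps)
      with x t show ?thesis
        by (simp only: dist_norm scaleR_left_diff_distrib [symmetric] norm_scaleR abs_mult)
    qed
    finally show "disjnt (ball (c i *\<^sub>R x) (t / 8)) (ball (c j *\<^sub>R x) (t / 8))"
      by (intro disjoint_ballI [folded disjnt_def]) simp
  qed
  have fm: "ball y r \<in> fmeasurable lborel" for y :: 'a and r
    using emeasure_lborel_ball_finite [of y r] by (intro fmeasurableI) auto
  have "unit_ball_vol DIM('a) / 8 ^ DIM('a) * t ^ (DIM('a) - 1) =
      1 / t * (unit_ball_vol DIM('a) * (t / 8) ^ DIM('a))"
    using t by (simp add: power_divide power_eq_if [of t])
  also have "\<dots> \<le> real N * (unit_ball_vol DIM('a) * (t / 8) ^ DIM('a))"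
    using N t by (intro mult_right_mono) auto
  also have "\<dots> = (\<Sum>j<N. measure lborel (ball (c j *\<^sub>R x) (t / 8)))"
    using t by (simp add: content_ball)
  also have "\<dots> = measure lborel (\<Union>j<N. ball (c j *\<^sub>R x) (t / 8))"
    by (intro measure_UNION' [symmetric] disj fm) auto
  also have "\<dots> \<le> measure lborel (solid_cap t x)"
    using ball by (intro measure_mono_fmeasurable solid_cap_fmeasurable) auto
  finally have "unit_ball_vol DIM('a) / 8 ^ DIM('a) * t ^ (DIM('a) - 1) \<le> measure lborel (solid_cap t x)" .
  from mult_left_mono [OF this of_nat_0_le_iff [of "DIM('a)"]] show ?thesis
    by (simp add: measure_cap mult_ac)
qed

text \<open>
  Every point over the cap is within distance \<open>t\<close> of the ray through \<open>x\<close>; hence about \<open>1 / t\<close> balls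
  of radius \<open>2 t\<close> with centres on that ray cover the part of the unit ball over the cap.
\<close>

lemma measure_cap_le:
  fixes x :: "'a::euclidean_space"
  assumes x: "norm x = 1" and t: "0 < t" "t \<le> 1"
  shows "measure \<sigma> (cap t x) \<le> 2 * DIM('a) * unit_ball_vol DIM('a) * 2 ^ DIM('a) * t ^ (DIM('a) - 1)"
proof -
  define N where "N = nat \<lfloor>1 / t\<rfloor>"
  have N: "real N \<le> 1 / t" using t by (simp add: N_def)
  have sub: "solid_cap t x \<subseteq> (\<Union>j\<le>N. cball ((real j * t) *\<^sub>R x) (2 * t))"
  proof
    fix z assume "z \<in> solid_cap t x"
    then have z: "norm z \<le> 1" "cos t * norm z \<le> x \<bullet> z" by (auto simp: solid_cap_def)
    define j where "j = nat \<lfloor>norm z / t\<rfloor>"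
    have "norm z / t \<le> 1 / t" using z(1) t by (simp add: divide_right_mono)
    then have "j \<le> N" unfolding j_def N_def by (intro nat_mono floor_mono)
    have "0 \<le> norm z / t" using t by simp
    then have "real j \<le> norm z / t \<and> norm z / t \<le> real j + 1"
      unfolding j_def by linarith
    then have j: "real j * t \<le> norm z" "norm z \<le> real j * t + t"
      using t by (auto simp: field_simps)
    have "(norm (z - norm z *\<^sub>R x))\<^sup>2 = 2 * (norm z)\<^sup>2 - 2 * norm z * (x \<bullet> z)"
      unfolding norm_diff_scaleR_square [OF x] by (simp add: algebra_simps)
    also have "\<dots> \<le> 2 * (norm z)\<^sup>2 - 2 * norm z * (cos t * norm z)"
      using mult_left_mono [OF z(2), of "2 * norm z"] by simp
    also have "\<dots> = (norm z)\<^sup>2 * (2 * (1 - cos t))"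
      by (simp add: algebra_simps power2_eq_square)
    also have "\<dots> \<le> 1 * t\<^sup>2"
      using z(1) one_minus_cos_le [of t] by (intro mult_mono) (auto simp: power_le_one)
    finally have 1: "norm (z - norm z *\<^sub>R x) \<le> t"
      using t by (simp add: power2_le_iff_abs_le)
    have "norm (norm z *\<^sub>R x - (real j * t) *\<^sub>R x) \<le> t"
      using j x by (simp flip: scaleR_left_diff_distrib)
    from norm_triangle_le [OF add_mono [OF 1 this]]
    have "z \<in> cball ((real j * t) *\<^sub>R x) (2 * t)"
      by (simp add: dist_norm norm_minus_commute)
    with \<open>j \<le> N\<close> show "z \<in> (\<Union>j\<le>N. cball ((real j * t) *\<^sub>R x) (2 * t))" by blast
  qed
  have fm: "cball y r \<in> fmeasurable lborel" for y :: 'a and r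
    using emeasure_lborel_cball_finite [of y r] by (intro fmeasurableI) auto
  have "measure lborel (solid_cap t x) \<le> measure lborel (\<Union>j\<le>N. cball ((real j * t) *\<^sub>R x) (2 * t))"
    using sub by (intro measure_mono_fmeasurable fmeasurable.finite_UN) (auto intro!: fm)
  also have "\<dots> \<le> (\<Sum>j\<le>N. measure lborel (cball ((real j * t) *\<^sub>R x) (2 * t)))"
    by (intro measure_UNION_le) auto
  also have "\<dots> = (real N + 1) * (unit_ball_vol DIM('a) * (2 * t) ^ DIM('a))"
    using t by (simp add: content_cball add.commute)
  also have "\<dots> \<le> (2 / t) * (unit_ball_vol DIM('a) * (2 * t) ^ DIM('a))"
  proof (rule mult_right_mono)
    have "1 \<le> 1 / t" using t by simp
    with N show "real N + 1 \<le> 2 / t" by simp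
  qed (use t in auto)
  also have "\<dots> = 2 * unit_ball_vol DIM('a) * 2 ^ DIM('a) * t ^ (DIM('a) - 1)"
    using t by (simp add: power_mult_distrib power_eq_if [of t])
  finally have "measure lborel (solid_cap t x) \<le>
      2 * unit_ball_vol DIM('a) * 2 ^ DIM('a) * t ^ (DIM('a) - 1)" .
  from mult_left_mono [OF this of_nat_0_le_iff [of "DIM('a)"]] show ?thesis
    by (simp add: measure_cap mult_ac)
qed

text \<open>
  Upper and lower bounds of the same order compare the measures of caps with different centres up to
  a constant factor.
\<close>

lemma cap_measure_bounds:
  obtains c C :: real where "0 < c" "0 < C"
    "\<And>t (y :: 'a::euclidean_space). 0 < t \<Longrightarrow> t \<le> 1 \<Longrightarrow> norm y = 1 \<Longrightarrow>
      c * t ^ (DIM('a) - 1) \<le> measure \<sigma> (cap t y) \<and> measure \<sigma> (cap t y) \<le> C * t ^ (DIM('a) - 1)"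
proof (rule that)
  show "0 < DIM('a) * unit_ball_vol DIM('a) / 8 ^ DIM('a)"
    "0 < 2 * DIM('a) * unit_ball_vol DIM('a) * 2 ^ DIM('a)" by simp_all
qed (use measure_cap_ge measure_cap_le in blast)

section \<open>Averages over caps as an integral operator\<close>

abbreviation (input) cap_indicator :: "real \<Rightarrow> 'a::euclidean_space \<Rightarrow> 'a \<Rightarrow> real" where
  "cap_indicator t y w \<equiv> indicator (cap t y) w"

lemma measurable_ident_sphere: "(\<lambda>x. x) \<in> borel_measurable \<sigma>"
proof -
  have "(\<lambda>x. x) \<in> borel_measurable (restrict_space borel (sphere 0 1))"
    by (intro measurable_restrict_space1) simp
  then show ?thesis
    by (subst measurable_cong_sets [OF sets_sphere_measure refl])
qed

lemma measurable_cap_indicator [measurable]: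
  "(\<lambda>p. cap_indicator t (fst p) (snd p)) \<in> borel_measurable (\<sigma> \<Otimes>\<^sub>M (\<sigma> :: 'a::euclidean_space measure))"
proof -
  have [measurable]: "fst \<in> borel_measurable (\<sigma> \<Otimes>\<^sub>M (\<sigma> :: 'a measure))"
    "snd \<in> borel_measurable (\<sigma> \<Otimes>\<^sub>M (\<sigma> :: 'a measure))"
    using measurable_compose [OF measurable_fst measurable_ident_sphere]
      measurable_compose [OF measurable_snd measurable_ident_sphere] by auto
  have "(\<lambda>p. if cos t \<le> fst p \<bullet> snd p then 1 else 0 :: real) \<in> borel_measurable (\<sigma> \<Otimes>\<^sub>M (\<sigma> :: 'a measure))"
    by measurable
  then show ?thesis
    by (rule measurable_cong [THEN iffD1, rotated])
      (auto simp: space_pair_measure cap_def indicator_def)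
qed

lemma cap_Int_sphere [simp]: "cap t y \<inter> sphere 0 1 = cap t y"
  by (auto simp: cap_def)

lemma integral_cap_indicator: "(LINT w|\<sigma>. cap_indicator t y w) = measure \<sigma> (cap t y)"
  by simp

lemma measurable_measure_cap [measurable]: "(\<lambda>y. measure \<sigma> (cap t y)) \<in> borel_measurable (\<sigma> :: 'a::euclidean_space measure)"
proof -
  interpret P: pair_sigma_finite "\<sigma> :: 'a measure" "\<sigma> :: 'a measure" by (rule pair_sigma_finite_sphere_measure)
  have "(\<lambda>y. LINT w|\<sigma>. cap_indicator t y w) \<in> borel_measurable (\<sigma> :: 'a measure)"
    using measurable_cap_indicator [of t] by (intro P.M1.borel_measurable_lebesgue_integral) (simp add: case_prod_unfold)
  then show ?thesis by (simp only: integral_cap_indicator)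
qed

definition cap_kernel :: "real \<Rightarrow> 'a::euclidean_space \<Rightarrow> 'a \<Rightarrow> complex" where
  "cap_kernel t y w = complex_of_real (cap_indicator t y w / measure \<sigma> (cap t y))"

text \<open>
  The row of \<open>y\<close> takes the single nonzero value \<open>1 / measure \<sigma> (cap t y)\<close> on a set of measure
  \<open>measure \<sigma> (cap t y)\<close>, so the integral of its square is \<open>1 / measure \<sigma> (cap t y)\<close>.
\<close>

lemma cap_kernel_L2:
  fixes c :: real
  assumes c: "0 < c" "\<And>y::'a::euclidean_space. norm y = 1 \<Longrightarrow> c \<le> measure \<sigma> (cap t y)"
  shows "case_prod (cap_kernel t) \<in> L2_fun (\<sigma> \<Otimes>\<^sub>M (\<sigma> :: 'a measure))"
    and "(LINT y|(\<sigma> :: 'a measure). LINT w|\<sigma>. (cmod (cap_kernel t y w))\<^sup>2) \<le> measure \<sigma> (sphere (0::'a) 1) / c"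
proof -
  interpret finite_measure "\<sigma> :: 'a measure" by (rule finite_measure_sphere_measure)
  interpret P: pair_sigma_finite "\<sigma> :: 'a measure" "\<sigma> :: 'a measure" ..
  interpret PP: finite_measure "\<sigma> \<Otimes>\<^sub>M (\<sigma> :: 'a measure)"
    by (intro finite_measure_pair_measure finite_measure_sphere_measure)
  have m: "(\<lambda>p. cap_kernel t (fst p) (snd p)) \<in> borel_measurable (\<sigma> \<Otimes>\<^sub>M (\<sigma> :: 'a measure))"
    unfolding cap_kernel_def by measurable
  have sq: "(cmod (cap_kernel t y w))\<^sup>2 = cap_indicator t y w * (1 / (measure \<sigma> (cap t y))\<^sup>2)" for y w :: 'a
    by (simp add: cap_kernel_def indicator_def power_divide norm_divide)
  have "norm ((cmod (cap_kernel t (fst p) (snd p)))\<^sup>2) \<le> 1 / c\<^sup>2" if "p \<in> space (\<sigma> \<Otimes>\<^sub>M (\<sigma> :: 'a measure))" for p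
  proof -
    have "1 / (measure \<sigma> (cap t (fst p)))\<^sup>2 \<le> 1 / c\<^sup>2"
      using that c by (intro frac_le power_mono) (auto simp: space_pair_measure)
    then show ?thesis unfolding sq by (auto simp: indicator_def)
  qed
  then have "integrable (\<sigma> \<Otimes>\<^sub>M (\<sigma> :: 'a measure)) (\<lambda>p. (cmod (cap_kernel t (fst p) (snd p)))\<^sup>2)"
    using m by (intro PP.integrable_const_bound [of _ "1 / c\<^sup>2"]) auto
  with m show L2: "case_prod (cap_kernel t) \<in> L2_fun (\<sigma> \<Otimes>\<^sub>M (\<sigma> :: 'a measure))"
    by (simp add: L2_fun_def case_prod_unfold)
  have "(LINT y|(\<sigma> :: 'a measure). LINT w|\<sigma>. (cmod (cap_kernel t y w))\<^sup>2) \<le> (LINT y|(\<sigma> :: 'a measure). 1 / c)"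
  proof (rule integral_mono)
    show "integrable (\<sigma> :: 'a measure) (\<lambda>y. LINT w|\<sigma>. (cmod (cap_kernel t y w))\<^sup>2)"
      by (rule L2_kernel_sections [OF L2])
    fix y :: 'a assume "y \<in> space \<sigma>"
    then have "c \<le> measure \<sigma> (cap t y)" using c by simp
    then have le: "1 / measure \<sigma> (cap t y) \<le> 1 / c" and pos: "0 < measure \<sigma> (cap t y)"
      using c(1) by (auto intro: frac_le)
    have "(LINT w|\<sigma>. (cmod (cap_kernel t y w))\<^sup>2) = 1 / measure \<sigma> (cap t y)"
      unfolding sq integral_mult_left_zero integral_cap_indicator using pos by (simp add: power2_eq_square)
    with le show "(LINT w|\<sigma>. (cmod (cap_kernel t y w))\<^sup>2) \<le> 1 / c"
      by (simp only:)
  qed simp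
  then show "(LINT y|(\<sigma> :: 'a measure). LINT w|\<sigma>. (cmod (cap_kernel t y w))\<^sup>2) \<le> measure \<sigma> (sphere (0::'a) 1) / c"
    by simp
qed

lemma integral_cap_kernel: "(LINT w|\<sigma>. cap_kernel t y w * f w) = cap_average t f y"
proof -
  have "cap_kernel t y w * f w = inverse (measure \<sigma> (cap t y)) *\<^sub>R (indicator (cap t y) w *\<^sub>R f w)" for w
    by (simp add: cap_kernel_def scaleR_conv_of_real field_simps)
  then show ?thesis
    unfolding cap_average_def set_lebesgue_integral_def by (simp only: integral_scaleR_right)
qed

section \<open>The kernel of the square root\<close>

locale square_root_kernel =
  fixes K Kh :: "'a::euclidean_space \<Rightarrow> 'a \<Rightarrow> complex"
  assumes K_L2: "case_prod K \<in> L2_fun (\<sigma> \<Otimes>\<^sub>M \<sigma>)"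
    and Kh_measurable: "case_prod Kh \<in> borel_measurable (\<sigma> \<Otimes>\<^sub>M \<sigma>)"
    and hermitian: "norm x = 1 \<Longrightarrow> norm y = 1 \<Longrightarrow> Kh x y = cnj (Kh y x)"
    and factor: "norm y = 1 \<Longrightarrow> norm w = 1 \<Longrightarrow>
      has_bochner_integral \<sigma> (\<lambda>x. Kh x y * Kh w x) (K w y)"
begin

sublocale finite_measure "\<sigma> :: 'a measure" by (rule finite_measure_sphere_measure)

sublocale P: pair_sigma_finite "\<sigma> :: 'a measure" "\<sigma> :: 'a measure" ..

lemma Kh_pair_measurable [measurable]: "(\<lambda>p. Kh (fst p) (snd p)) \<in> borel_measurable (\<sigma> \<Otimes>\<^sub>M \<sigma>)"
  using Kh_measurable by (simp add: case_prod_unfold)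

lemma K_pair_measurable [measurable]: "(\<lambda>p. K (fst p) (snd p)) \<in> borel_measurable (\<sigma> \<Otimes>\<^sub>M \<sigma>)"
  using L2_funD(1) [OF K_L2] by (simp add: case_prod_unfold)

text \<open>
  By hermiticity, \<open>K w y\<close> is the inner product of the rows \<open>Kh w\<close> and \<open>Kh y\<close>.
\<close>

lemma K_inner_rows: "norm y = 1 \<Longrightarrow> norm w = 1 \<Longrightarrow>
    has_bochner_integral \<sigma> (\<lambda>x. Kh w x * cnj (Kh y x)) (K w y)"
  using factor [of y w] hermitian [of _ y]
  by (subst has_bochner_integral_cong [OF refl _ refl]) (auto simp: mult.commute)

definition row_square :: "'a \<Rightarrow> real" where
  "row_square y = (LINT x|\<sigma>. (cmod (Kh y x))\<^sup>2)"

lemma Kh_row_L2: "norm y = 1 \<Longrightarrow> Kh y \<in> L2_fun \<sigma>"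
proof -
  assume y: "norm y = 1"
  have "integrable \<sigma> (\<lambda>x. Re (Kh y x * cnj (Kh y x)))"
    using K_inner_rows [OF y y] by (intro integrable_Re) (auto simp: has_bochner_integral_iff)
  moreover have "Re (z * cnj z) = (cmod z)\<^sup>2" for z
    by (simp add: complex_mult_cnj cmod_power2)
  moreover have "Kh y \<in> borel_measurable \<sigma>"
    using y measurable_Pair2 [OF Kh_measurable, of y] by simp
  ultimately show ?thesis
    by (simp add: L2_fun_def)
qed

lemma Kh_column_L2: "norm x = 1 \<Longrightarrow> (\<lambda>w. Kh w x) \<in> L2_fun \<sigma>"
proof -
  assume x: "norm x = 1"
  have "(\<lambda>w. cnj (Kh x w)) \<in> L2_fun \<sigma>"
    by (intro L2_fun_cnj Kh_row_L2 x)
  moreover have "(\<lambda>w. Kh w x) \<in> borel_measurable \<sigma>"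
    using x measurable_Pair1 [OF Kh_measurable, of x] by simp
  moreover have "integrable \<sigma> (\<lambda>w. (cmod (Kh w x))\<^sup>2) \<longleftrightarrow> integrable \<sigma> (\<lambda>w. (cmod (cnj (Kh x w)))\<^sup>2)"
    using x by (intro Bochner_Integration.integrable_cong) (auto simp: hermitian [of _ x])
  ultimately show ?thesis
    by (simp add: L2_fun_def)
qed

lemma K_diagonal: "norm y = 1 \<Longrightarrow> K y y = complex_of_real (row_square y)"
  using has_bochner_integral_integral_eq [OF K_inner_rows [of y y]] cinner_self_Re [of "Kh y"] by (simp add: row_square_def)

lemma row_square_nonneg: "0 \<le> row_square y"
  unfolding row_square_def by simp

lemma row_square_measurable [measurable]: "row_square \<in> borel_measurable \<sigma>"
  unfolding row_square_def [abs_def]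
  by (intro borel_measurable_lebesgue_integral) (simp add: case_prod_unfold)

text \<open>
  The law of cosines for the rows \<open>Kh y\<close> and \<open>Kh w\<close>.
\<close>

lemma row_distance:
  assumes "norm y = 1" "norm w = 1"
  shows "has_bochner_integral \<sigma> (\<lambda>x. (cmod (Kh y x - Kh w x))\<^sup>2) (row_square y + row_square w - 2 * Re (K y w))"
proof -
  define h where "h x = Kh y x * cnj (Kh w x)" for x
  have "has_bochner_integral \<sigma> h (K y w)"
    unfolding h_def [abs_def] by (rule K_inner_rows [OF assms(2,1)])
  then have "has_bochner_integral \<sigma> (\<lambda>x. (cmod (Kh y x))\<^sup>2 + (cmod (Kh w x))\<^sup>2 - 2 * Re (h x))
      (row_square y + row_square w - 2 * Re (K y w))"
    using L2_funD(2) [OF Kh_row_L2 [OF assms(1)]] L2_funD(2) [OF Kh_row_L2 [OF assms(2)]]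
    by (auto simp: has_bochner_integral_iff row_square_def)
  moreover have "(cmod (a - b))\<^sup>2 = (cmod a)\<^sup>2 + (cmod b)\<^sup>2 - 2 * Re (a * cnj b)" for a b
    by (simp only: cmod_power2) (simp add: power2_eq_square algebra_simps)
  ultimately show ?thesis by (simp only: h_def)
qed

lemma L2_product_integrable:
  assumes "f \<in> L2_fun (\<sigma> \<Otimes>\<^sub>M (\<sigma> :: 'a measure))"
  shows "integrable (\<sigma> \<Otimes>\<^sub>M (\<sigma> :: 'a measure)) f"
proof -
  interpret PP: finite_measure "\<sigma> \<Otimes>\<^sub>M (\<sigma> :: 'a measure)"
    by (intro finite_measure_pair_measure finite_measure_sphere_measure)
  have "(\<lambda>x. 1) \<in> L2_fun (\<sigma> \<Otimes>\<^sub>M (\<sigma> :: 'a measure))"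
    by (simp add: L2_fun_def)
  from L2_fun_integrable_mult [OF assms this] show ?thesis by simp
qed

end

section \<open>The averaged Hoelder condition\<close>

locale averaged_holder_kernel = square_root_kernel K Kh for K Kh :: "'a::euclidean_space \<Rightarrow> 'a \<Rightarrow> complex" +
  fixes B :: "'a \<Rightarrow> real" and b \<beta> :: real
  assumes B_measurable [measurable]: "B \<in> borel_measurable \<sigma>"
    and B_bound: "AE y in \<sigma>. \<bar>B y\<bar> \<le> b"
    and holder: "averaged_holder B \<beta> K"
begin

text \<open>
  The Hoelder condition at the diagonal point \<open>x = y\<close>.
\<close>

lemma row_square_le:
  assumes y: "norm y = 1" and t: "0 < t" "t < pi"
  shows "row_square y \<le> Re (cap_average t (K y) y) + B y * t powr \<beta>"
proof -
  have "cmod (cap_average t (K y) y - K y y) \<le> B y * t powr \<beta>"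
    using holder y t unfolding averaged_holder_def by simp
  then have "\<bar>Re (cap_average t (K y) y - K y y)\<bar> \<le> B y * t powr \<beta>"
    using abs_Re_le_cmod order_trans by blast
  then show ?thesis
    by (simp add: K_diagonal [OF y])
qed

lemma cap_indicator_integrable: "integrable \<sigma> (\<lambda>w. cap_indicator t (y :: 'a) w)"
  by (rule integrable_const_bound [of _ 1]) (auto intro: borel_measurable_indicator cap_sets)

lemma B_integrable: "integrable \<sigma> B"
  using B_bound by (intro integrable_const_bound [of _ b]) auto

text \<open>
  This is the finiteness of the trace.  The condition at \<open>t = 1\<close> bounds \<open>K y y\<close> by \<open>B y\<close> and an average
  of \<open>K y\<close> over a cap whose measure is bounded below; the latter is integrable in \<open>y\<close> because \<open>K\<close> is.
\<close>

lemma row_square_integrable: "integrable \<sigma> row_square"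
proof -
  define c where "c = DIM('a) * unit_ball_vol DIM('a) / 8 ^ DIM('a)"
  have c: "0 < c" "norm y = 1 \<Longrightarrow> c \<le> measure \<sigma> (cap 1 y)" for y :: 'a
    using measure_cap_ge [of y 1] by (auto simp: c_def)
  have Kint: "integrable (\<sigma> \<Otimes>\<^sub>M \<sigma>) (\<lambda>(y, w). K y w)"
    using L2_product_integrable [OF K_L2] by (simp add: case_prod_unfold)
  show ?thesis
  proof (rule Bochner_Integration.integrable_bound)
    have "integrable \<sigma> (\<lambda>y. LINT w|\<sigma>. cmod (K y w))"
      using P.integrable_fst [of "\<lambda>y w. cmod (K y w)"] integrable_norm [OF Kint]
      by (simp add: case_prod_unfold)
    then show "integrable \<sigma> (\<lambda>y. 1 / c * (LINT w|\<sigma>. cmod (K y w)) + B y)"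
      using B_integrable by auto
    show "AE y in \<sigma>. norm (row_square y) \<le> norm (1 / c * (LINT w|\<sigma>. cmod (K y w)) + B y)"
      using P.AE_integrable_fst [OF Kint] AE_space
    proof eventually_elim
      case (elim y)
      then have y: "norm y = 1" by simp
      have "cmod (cap_average 1 (K y) y) \<le> (LINT w|\<sigma>. cmod (cap_kernel 1 y w * K y w))"
        unfolding integral_cap_kernel [symmetric] by (rule integral_norm_bound)
      also have "\<dots> \<le> (LINT w|\<sigma>. 1 / c * cmod (K y w))"
      proof (rule Bochner_Integration.integral_mono')
        show "integrable \<sigma> (\<lambda>w. 1 / c * cmod (K y w))"
          using elim by auto
        fix w
        have "cmod (cap_kernel 1 y w) \<le> 1 / c"
          using c(1) c(2) [OF y] by (auto simp: cap_kernel_def indicator_def norm_divide intro!: frac_le)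
        then show "cmod (cap_kernel 1 y w * K y w) \<le> 1 / c * cmod (K y w)"
          unfolding norm_mult by (intro mult_right_mono) auto
      qed (use c(1) in simp)
      finally have "row_square y \<le> 1 / c * (LINT w|\<sigma>. cmod (K y w)) + B y"
        using row_square_le [OF y, of 1] pi_gt3 complex_Re_le_cmod [of "cap_average 1 (K y) y"] by simp
      then show ?case using row_square_nonneg [of y] by simp
    qed
  qed measurable
qed

lemma Kh_L2: "case_prod Kh \<in> L2_fun (\<sigma> \<Otimes>\<^sub>M \<sigma>)"
proof -
  have "integrable (\<sigma> \<Otimes>\<^sub>M \<sigma>) (\<lambda>p. (cmod (Kh (fst p) (snd p)))\<^sup>2)"
  proof (rule P.Fubini_integrable)
    show "integrable \<sigma> (\<lambda>y. LINT x|\<sigma>. norm ((cmod (Kh (fst (y, x)) (snd (y, x))))\<^sup>2))"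
      using row_square_integrable by (simp add: row_square_def [abs_def])
    show "AE y in \<sigma>. integrable \<sigma> (\<lambda>x. (cmod (Kh (fst (y, x)) (snd (y, x))))\<^sup>2)"
      using AE_space by eventually_elim (simp add: L2_funD(2) [OF Kh_row_L2])
  qed measurable
  then show ?thesis
    using Kh_measurable by (simp add: L2_fun_def case_prod_unfold)
qed

text \<open>
  By \<open>row_distance\<close>, the integral of the squared distance of the rows \<open>Kh y\<close> and \<open>Kh w\<close> over all \<open>w\<close> in
  the cap around \<open>y\<close>.
\<close>

definition deviation :: "real \<Rightarrow> 'a \<Rightarrow> real" where
  "deviation t y = (LINT w|\<sigma>. cap_indicator t y w * (row_square y + row_square w - 2 * Re (K y w)))"

lemma cap_indicator_commute: "norm y = 1 \<Longrightarrow> norm w = 1 \<Longrightarrow> cap_indicator t y w = cap_indicator t w y"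
  by (simp add: cap_def indicator_def inner_commute)

lemma integrable_cap_indicator_mult:
  fixes f :: "'a \<times> 'a \<Rightarrow> real"
  assumes "integrable (\<sigma> \<Otimes>\<^sub>M \<sigma>) f"
  shows "integrable (\<sigma> \<Otimes>\<^sub>M \<sigma>) (\<lambda>p. cap_indicator t (fst p) (snd p) * f p)"
  using assms
proof (rule Bochner_Integration.integrable_bound)
  show "(\<lambda>p. cap_indicator t (fst p) (snd p) * f p) \<in> borel_measurable (\<sigma> \<Otimes>\<^sub>M \<sigma>)"
    using borel_measurable_integrable [OF assms] by measurable
qed (auto simp: indicator_def)

text \<open>
  The relation \<open>w \<in> cap t y\<close> is symmetric, so the two diagonal terms \<open>row_square y\<close> and \<open>row_square w\<close> have
  the same integral.  What remains is twice the integral of \<open>row_square y - Re (K y w)\<close> over \<open>w \<in> cap t y\<close>,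
  which is the quantity that the Hoelder condition at the diagonal controls.
\<close>

lemma integral_deviation:
  assumes t: "0 < t" "t \<le> 1"
  shows "integrable \<sigma> (deviation t)"
    and "(LINT y|\<sigma>. deviation t y) \<le> 2 * t powr \<beta> * (LINT y|\<sigma>. measure \<sigma> (cap t y) * B y)"
proof -
  let ?\<chi> = "\<lambda>p. cap_indicator t (fst p) (snd p)"
  have d1: "integrable (\<sigma> \<Otimes>\<^sub>M (\<sigma> :: 'a measure)) (\<lambda>p. row_square (fst p))"
    using row_square_integrable row_square_nonneg by (intro P.Fubini_integrable) auto
  have d2: "integrable ((\<sigma> :: 'a measure) \<Otimes>\<^sub>M \<sigma>) (\<lambda>p. row_square (snd p))"
    using row_square_integrable row_square_nonneg by (intro P.Fubini_integrable) auto
  have k: "integrable (\<sigma> \<Otimes>\<^sub>M \<sigma>) (\<lambda>p. Re (K (fst p) (snd p)))"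
    using L2_product_integrable [OF K_L2] by (auto simp: case_prod_unfold)
  note i1 = integrable_cap_indicator_mult [OF d1, of t]
    and i2 = integrable_cap_indicator_mult [OF d2, of t]
    and i3 = integrable_cap_indicator_mult [OF k, of t]
  have eq: "?\<chi> p * (row_square (fst p) + row_square (snd p) - 2 * Re (K (fst p) (snd p))) =
      ?\<chi> p * row_square (fst p) + ?\<chi> p * row_square (snd p) - 2 * (?\<chi> p * Re (K (fst p) (snd p)))" for p
    by (simp add: algebra_simps)
  have i: "integrable (\<sigma> \<Otimes>\<^sub>M \<sigma>) (\<lambda>p. ?\<chi> p * (row_square (fst p) + row_square (snd p) - 2 * Re (K (fst p) (snd p))))"
    unfolding eq using i1 i2 i3 by auto
  have dev: "deviation t = (\<lambda>y. LINT w|\<sigma>. ?\<chi> (y, w) * (row_square (fst (y, w)) + row_square (snd (y, w)) - 2 * Re (K (fst (y, w)) (snd (y, w)))))"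
    by (simp add: deviation_def [abs_def])
  show "integrable \<sigma> (deviation t)"
    unfolding dev using P.integrable_fst' [OF i] by simp
  have swap: "(LINT p|(\<sigma> \<Otimes>\<^sub>M \<sigma>). ?\<chi> p * row_square (snd p)) = (LINT p|(\<sigma> \<Otimes>\<^sub>M \<sigma>). ?\<chi> p * row_square (fst p))"
  proof -
    have "(LINT p|(\<sigma> \<Otimes>\<^sub>M \<sigma>). ?\<chi> p * row_square (snd p)) = (LINT (x, y)|(\<sigma> \<Otimes>\<^sub>M \<sigma>). cap_indicator t y x * row_square x)"
      using P.integral_product_swap [OF borel_measurable_integrable [OF i2]] by simp
    also have "\<dots> = (LINT p|(\<sigma> \<Otimes>\<^sub>M \<sigma>). ?\<chi> p * row_square (fst p))"
      by (intro Bochner_Integration.integral_cong)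
        (auto simp: space_pair_measure case_prod_unfold cap_indicator_commute)
    finally show ?thesis .
  qed
  have double: "(LINT y|\<sigma>. deviation t y) =
      2 * (LINT p|(\<sigma> \<Otimes>\<^sub>M \<sigma>). ?\<chi> p * row_square (fst p) - ?\<chi> p * Re (K (fst p) (snd p)))"
  proof -
    have "(LINT y|\<sigma>. deviation t y) =
      (LINT p|(\<sigma> \<Otimes>\<^sub>M \<sigma>). ?\<chi> p * (row_square (fst p) + row_square (snd p) - 2 * Re (K (fst p) (snd p))))"
      unfolding dev by (rule P.integral_fst' [OF i])
    also have "\<dots> = 2 * (LINT p|(\<sigma> \<Otimes>\<^sub>M \<sigma>). ?\<chi> p * row_square (fst p) - ?\<chi> p * Re (K (fst p) (snd p)))"
      unfolding eq using i1 i2 i3 swap by simp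
    finally show ?thesis .
  qed
  have "(LINT p|(\<sigma> \<Otimes>\<^sub>M \<sigma>). ?\<chi> p * row_square (fst p) - ?\<chi> p * Re (K (fst p) (snd p))) =
      (LINT y|\<sigma>. LINT w|\<sigma>. ?\<chi> (y, w) * row_square (fst (y, w)) - ?\<chi> (y, w) * Re (K (fst (y, w)) (snd (y, w))))"
    by (rule P.integral_fst' [symmetric]) (use i1 i3 in auto)
  also have "\<dots> \<le> (LINT y|\<sigma>. t powr \<beta> * (measure \<sigma> (cap t y) * B y))"
  proof (rule integral_mono_AE)
    show "integrable \<sigma> (\<lambda>y. LINT w|\<sigma>. ?\<chi> (y, w) * row_square (fst (y, w)) - ?\<chi> (y, w) * Re (K (fst (y, w)) (snd (y, w))))"
      by (rule P.integrable_fst') (use i1 i3 in auto)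
    have "integrable \<sigma> (\<lambda>y. measure \<sigma> (cap t y) * B y)"
    proof (rule integrable_const_bound [of _ "measure \<sigma> (sphere (0::'a) 1) * b"])
      show "AE y in \<sigma>. norm (measure \<sigma> (cap t y) * B y) \<le> measure \<sigma> (sphere (0::'a) 1) * b"
        using B_bound by eventually_elim
          (auto simp: abs_mult bounded_measure [of "cap t _", simplified] intro!: mult_mono)
    qed measurable
    then show "integrable \<sigma> (\<lambda>y. t powr \<beta> * (measure \<sigma> (cap t y) * B y))" by simp
    have "AE y in \<sigma>. integrable \<sigma> (\<lambda>w. cap_indicator t y w * Re (K y w))"
      using P.AE_integrable_fst' [OF i3] by simp
    moreover have "AE y in \<sigma>. integrable \<sigma> (\<lambda>w. cap_indicator t y w *\<^sub>R K y w)"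
    proof -
      have "AE y in \<sigma>. integrable \<sigma> (\<lambda>w. K y w)"
        using P.AE_integrable_fst' [OF L2_product_integrable [OF K_L2]] by simp
      then show ?thesis
        by eventually_elim (intro integrable_mult_indicator cap_sets)
    qed
    ultimately show "AE y in \<sigma>. (LINT w|\<sigma>. ?\<chi> (y, w) * row_square (fst (y, w)) - ?\<chi> (y, w) * Re (K (fst (y, w)) (snd (y, w))))
        \<le> t powr \<beta> * (measure \<sigma> (cap t y) * B y)"
      using AE_space
    proof eventually_elim
      case (elim y)
      then have y: "norm y = 1" by simp
      have "(LINT w|\<sigma>. cap_indicator t y w * Re (K y w)) = Re (LINT w|\<sigma>. cap_indicator t y w *\<^sub>R K y w)"
        using elim by (subst integral_Re [symmetric]) auto
      also have "\<dots> = measure \<sigma> (cap t y) * Re (cap_average t (K y) y)"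
      proof -
        have "0 < measure \<sigma> (cap t y)"
          by (rule less_le_trans [OF _ measure_cap_ge [OF y t]]) (use t in simp)
        then show ?thesis
          by (simp add: cap_average_def set_lebesgue_integral_def)
      qed
      finally have Re_K: "(LINT w|\<sigma>. cap_indicator t y w * Re (K y w)) =
        measure \<sigma> (cap t y) * Re (cap_average t (K y) y)" .
      have "(LINT w|\<sigma>. cap_indicator t y w * row_square y - cap_indicator t y w * Re (K y w)) =
          (LINT w|\<sigma>. cap_indicator t y w * row_square y) - (LINT w|\<sigma>. cap_indicator t y w * Re (K y w))"
        using elim(1) by (intro Bochner_Integration.integral_diff integrable_mult_left cap_indicator_integrable)
      also have "\<dots> = measure \<sigma> (cap t y) * (row_square y - Re (cap_average t (K y) y))"
        unfolding Re_K by (simp only: integral_mult_left_zero integral_cap_indicator right_diff_distrib)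
      also have "\<dots> \<le> measure \<sigma> (cap t y) * (t powr \<beta> * B y)"
        using row_square_le [OF y, of t] t pi_gt3 by (intro mult_left_mono) (auto simp: mult.commute)
      finally show ?case by (simp add: mult_ac)
    qed
  qed
  finally have "(LINT p|(\<sigma> \<Otimes>\<^sub>M \<sigma>). ?\<chi> p * row_square (fst p) - ?\<chi> p * Re (K (fst p) (snd p)))
      \<le> t powr \<beta> * (LINT y|\<sigma>. measure \<sigma> (cap t y) * B y)"
    by (simp only: integral_mult_right_zero)
  then show "(LINT y|\<sigma>. deviation t y) \<le> 2 * t powr \<beta> * (LINT y|\<sigma>. measure \<sigma> (cap t y) * B y)"
    unfolding double by linarith
qed

text \<open>
  Cauchy-Schwarz for the indicator of the cap and \<open>Kh y x - Kh w x\<close> restricted to the cap.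
\<close>

lemma remainder_square_le:
  assumes y: "norm y = 1" and x: "norm x = 1"
  shows "(cmod (measure \<sigma> (cap t y) * Kh y x - (LINT w|\<sigma>. cap_indicator t y w * Kh w x)))\<^sup>2 \<le>
    measure \<sigma> (cap t y) * (LINT w|\<sigma>. cap_indicator t y w * (cmod (Kh y x - Kh w x))\<^sup>2)"
proof -
  let ?f = "\<lambda>w. complex_of_real (cap_indicator t y w)"
  let ?g = "\<lambda>w. ?f w * (Kh y x - Kh w x)"
  have f: "?f \<in> L2_fun \<sigma>"
  proof -
    have "(cmod (?f w))\<^sup>2 = cap_indicator t y w" for w
      by (simp add: indicator_def)
    then show ?thesis
      using cap_indicator_integrable [of t y] by (simp add: L2_fun_def)
  qed
  have L: "(\<lambda>w. Kh y x - Kh w x) \<in> L2_fun \<sigma>"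
    using L2_fun_add [OF _ L2_fun_scale [OF Kh_column_L2 [OF x], of "-1"], of "\<lambda>w. Kh y x"]
    by (simp add: L2_fun_def)
  have g: "?g \<in> L2_fun \<sigma>"
  proof -
    have "?g \<in> borel_measurable \<sigma>"
      using L2_funD(1) [OF f] L2_funD(1) [OF L] by (rule borel_measurable_times)
    moreover from this have "integrable \<sigma> (\<lambda>w. (cmod (?g w))\<^sup>2)"
      by (intro Bochner_Integration.integrable_bound [OF L2_funD(2) [OF L]])
        (auto simp: indicator_def)
    ultimately show ?thesis by (simp add: L2_fun_def)
  qed
  have "(LINT w|\<sigma>. ?f w * ?g w) = (LINT w|\<sigma>. ?f w * Kh y x - ?f w * Kh w x)"
    by (intro Bochner_Integration.integral_cong) (auto simp: indicator_def)
  also have "\<dots> = (LINT w|\<sigma>. ?f w * Kh y x) - (LINT w|\<sigma>. ?f w * Kh w x)"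
    by (intro Bochner_Integration.integral_diff L2_fun_integrable_mult f Kh_column_L2 x)
      (simp add: L2_fun_def)
  also have "(LINT w|\<sigma>. ?f w * Kh y x) = measure \<sigma> (cap t y) * Kh y x"
    by (simp add: integral_complex_of_real)
  finally have eq: "(LINT w|\<sigma>. ?f w * ?g w) =
      measure \<sigma> (cap t y) * Kh y x - (LINT w|\<sigma>. ?f w * Kh w x)" .
  have "(LINT w|\<sigma>. (cmod (?f w))\<^sup>2) = (LINT w|\<sigma>. cap_indicator t y w)"
    by (intro Bochner_Integration.integral_cong) (auto simp: indicator_def)
  then have sf: "(LINT w|\<sigma>. (cmod (?f w))\<^sup>2) = measure \<sigma> (cap t y)"
    by (simp only: integral_cap_indicator)
  have sg: "(LINT w|\<sigma>. (cmod (?g w))\<^sup>2) = (LINT w|\<sigma>. cap_indicator t y w * (cmod (Kh y x - Kh w x))\<^sup>2)"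
    by (intro Bochner_Integration.integral_cong) (auto simp: indicator_def)
  show ?thesis
    using L2_Cauchy_Schwarz [OF f g] unfolding eq sf sg .
qed

text \<open>
  The kernel of \<open>S - M S\<close>, where \<open>M\<close> averages over caps of radius \<open>t\<close>.
\<close>

definition remainder :: "real \<Rightarrow> 'a \<Rightarrow> 'a \<Rightarrow> complex" where
  "remainder t y x = Kh y x - (LINT w|\<sigma>. cap_kernel t y w * Kh w x)"

text \<open>
  The pointwise bound \<open>remainder_square_le\<close> is integrated over \<open>x\<close>.  Exchanging the integrals over \<open>x\<close>
  and \<open>w\<close> turns the inner one into the squared distance of two rows.
\<close>

lemma remainder_row:
  assumes t: "0 < t" "t \<le> 1" and y: "norm y = 1" and Ky: "K y \<in> L2_fun \<sigma>"
    and meas: "remainder t y \<in> borel_measurable \<sigma>"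
  shows "remainder t y \<in> L2_fun \<sigma>"
    and "(LINT x|\<sigma>. (cmod (remainder t y x))\<^sup>2) \<le> deviation t y / measure \<sigma> (cap t y)"
proof -
  let ?c = "measure \<sigma> (cap t y)"
  let ?H = "\<lambda>w x. cap_indicator t y w * (cmod (Kh y x - Kh w x))\<^sup>2"
  have c: "0 < ?c"
    by (rule less_le_trans [OF _ measure_cap_ge [OF y t]]) (use t in simp)
  have inner: "(LINT x|\<sigma>. ?H w x) = cap_indicator t y w * (row_square y + row_square w - 2 * Re (K y w))" if "norm w = 1" for w
    using row_distance [OF y that] by (simp add: has_bochner_integral_iff)
  have "(\<lambda>x. 1) \<in> L2_fun (\<sigma> :: 'a measure)" by (simp add: L2_fun_def)
  from L2_fun_integrable_mult [OF Ky this] have Kyint: "integrable \<sigma> (K y)" by simp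
  have "integrable \<sigma> (\<lambda>w. row_square y + row_square w - 2 * Re (K y w))"
    using row_square_integrable Kyint by auto
  from integrable_mult_indicator [OF cap_sets [of t y] this]
  have dint: "integrable \<sigma> (\<lambda>w. cap_indicator t y w * (row_square y + row_square w - 2 * Re (K y w)))"
    by simp
  have "(\<lambda>x. Kh y x) \<in> borel_measurable \<sigma>"
    by (rule L2_funD(1) [OF Kh_row_L2 [OF y]])
  then have [measurable]: "(\<lambda>p. Kh y (snd p)) \<in> borel_measurable ((\<sigma> :: 'a measure) \<Otimes>\<^sub>M \<sigma>)"
    by (simp add: measurable_compose [OF measurable_snd])
  have int: "integrable (\<sigma> \<Otimes>\<^sub>M \<sigma>) (\<lambda>(w, x). ?H w x)"
  proof (rule P.Fubini_integrable)
    have "(\<lambda>p. ?H (fst p) (snd p)) \<in> borel_measurable (\<sigma> \<Otimes>\<^sub>M \<sigma>)"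
      by measurable
    then show "(\<lambda>(w, x). ?H w x) \<in> borel_measurable (\<sigma> \<Otimes>\<^sub>M \<sigma>)"
      by (simp add: case_prod_unfold)
    have "integrable \<sigma> (\<lambda>w. LINT x|\<sigma>. ?H w x) \<longleftrightarrow>
        integrable \<sigma> (\<lambda>w. cap_indicator t y w * (row_square y + row_square w - 2 * Re (K y w)))"
      by (intro Bochner_Integration.integrable_cong inner) auto
    then show "integrable \<sigma> (\<lambda>w. LINT x|\<sigma>. norm (case (w, x) of (w, x) \<Rightarrow> ?H w x))"
      using dint by simp
    show "AE w in \<sigma>. integrable \<sigma> (\<lambda>x. case (w, x) of (w, x) \<Rightarrow> ?H w x)"
      using AE_space
    proof eventually_elim
      case (elim w)
      then show ?case
        using row_distance [OF y, of w] by (auto simp: has_bochner_integral_iff)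
    qed
  qed
  have Hx: "integrable \<sigma> (\<lambda>x. LINT w|\<sigma>. ?H w x)"
    using P.integrable_snd [OF int] .
  have "(LINT x|\<sigma>. LINT w|\<sigma>. ?H w x) = (LINT w|\<sigma>. LINT x|\<sigma>. ?H w x)"
    by (rule P.Fubini_integral [OF int])
  also have "\<dots> = deviation t y"
    unfolding deviation_def by (intro Bochner_Integration.integral_cong inner) auto
  finally have H: "(LINT x|\<sigma>. LINT w|\<sigma>. ?H w x) = deviation t y" .
  have le: "(cmod (remainder t y x))\<^sup>2 \<le> (LINT w|\<sigma>. ?H w x) / ?c" if x: "norm x = 1" for x
  proof -
    have "(LINT w|\<sigma>. cap_kernel t y w * Kh w x) = (LINT w|\<sigma>. (1 / ?c) * (cap_indicator t y w * Kh w x))"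
      by (simp add: cap_kernel_def)
    then have "?c * remainder t y x = ?c * Kh y x - (LINT w|\<sigma>. cap_indicator t y w * Kh w x)"
      using c by (simp add: remainder_def right_diff_distrib)
    then have "(cmod (?c * remainder t y x))\<^sup>2 \<le> ?c * (LINT w|\<sigma>. ?H w x)"
      using remainder_square_le [OF y x, of t] by simp
    then have "?c * (?c * (cmod (remainder t y x))\<^sup>2) \<le> ?c * (LINT w|\<sigma>. ?H w x)"
      by (simp add: norm_mult power_mult_distrib power2_eq_square [of ?c] mult.assoc)
    then show ?thesis
      using c by (simp add: pos_le_divide_eq mult.commute)
  qed
  have Hc: "integrable \<sigma> (\<lambda>x. (LINT w|\<sigma>. ?H w x) / ?c)"
    using Hx by simp
  have sq: "integrable \<sigma> (\<lambda>x. (cmod (remainder t y x))\<^sup>2)"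
  proof (rule Bochner_Integration.integrable_bound [OF Hc])
    show "AE x in \<sigma>. norm ((cmod (remainder t y x))\<^sup>2) \<le> norm ((LINT w|\<sigma>. ?H w x) / ?c)"
      using AE_space
    proof eventually_elim
      case (elim x)
      then show ?case using order_trans [OF le [of x] abs_ge_self] by simp
    qed
  qed (use meas in measurable)
  with meas show "remainder t y \<in> L2_fun \<sigma>"
    by (simp add: L2_fun_def)
  have "(LINT x|\<sigma>. (cmod (remainder t y x))\<^sup>2) \<le> (LINT x|\<sigma>. (LINT w|\<sigma>. ?H w x) / ?c)"
    using sq Hc by (rule integral_mono) (simp add: le)
  also have "\<dots> = deviation t y / ?c"
    by (simp add: H)
  finally show "(LINT x|\<sigma>. (cmod (remainder t y x))\<^sup>2) \<le> deviation t y / ?c" .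
qed

abbreviation (input) averaging :: "real \<Rightarrow> 'a sphere_L2 \<Rightarrow> 'a sphere_L2" where
  "averaging t \<equiv> integral_operator (cap_kernel t)"

text \<open>
  In \<open>integral_deviation\<close> the measure of the cap appears as a factor and in \<open>remainder_row\<close> as a divisor.
  With bounds of the same order in both places the powers of \<open>t\<close> that come from caps cancel.
\<close>

lemma hs_le_remainder:
  fixes c C t :: real
  assumes S: "generated_by_kernel S Kh" and t: "0 < t" "t \<le> 1" and c: "0 < c"
    and cap: "\<And>y :: 'a. norm y = 1 \<Longrightarrow> c \<le> measure \<sigma> (cap t y)"
      "\<And>y :: 'a. norm y = 1 \<Longrightarrow> measure \<sigma> (cap t y) \<le> C"
  shows "hs_le (\<lambda>f. S f - averaging t (S f)) (2 * (C / c) * (LINT y|\<sigma>. \<bar>B y\<bar>) * t powr \<beta>)"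
proof -
  have cap_L2: "case_prod (cap_kernel t) \<in> L2_fun (\<sigma> \<Otimes>\<^sub>M (\<sigma> :: 'a measure))"
    by (rule cap_kernel_L2(1) [OF c cap(1)])
  have gen: "generated_by_kernel (\<lambda>f. S f - averaging t (S f)) (remainder t)"
    unfolding remainder_def [abs_def]
    by (rule generated_by_kernel_diff [OF S generated_by_kernel_compose
          [OF generated_by_kernel_integral_operator [OF cap_L2] cap_L2 S Kh_L2]])
  have "hs_le (\<lambda>f. S f - averaging t (S f)) (LINT y|\<sigma>. deviation t y / c)"
  proof (rule hs_le_kernel [OF gen])
    show "integrable \<sigma> (\<lambda>y. deviation t y / c)"
      using integral_deviation(1) [OF t] by simp
    show "AE y in \<sigma>. remainder t y \<in> L2_fun \<sigma> \<and>
        (LINT x|\<sigma>. (cmod (remainder t y x))\<^sup>2) \<le> deviation t y / c"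
      using L2_kernel_sections(1) [OF K_L2] AE_space
    proof eventually_elim
      case (elim y)
      then have y: "norm y = 1" by simp
      have "case_prod (remainder t) \<in> borel_measurable (\<sigma> \<Otimes>\<^sub>M \<sigma>)"
        using gen by (simp add: generated_by_kernel_def)
      then have m: "remainder t y \<in> borel_measurable \<sigma>"
        using y measurable_Pair2 [of "case_prod (remainder t)" \<sigma> \<sigma> borel y] by simp
      note row = remainder_row [OF t y elim(1) m]
      have "0 \<le> deviation t y / measure \<sigma> (cap t y)"
        by (rule order_trans [OF _ row(2)]) simp
      then have "0 \<le> deviation t y"
        using c cap(1) [OF y] by (simp add: zero_le_divide_iff)
      then have "deviation t y / measure \<sigma> (cap t y) \<le> deviation t y / c"
        using c cap(1) [OF y] by (intro divide_left_mono) auto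
      with row show ?case by simp
    qed
  qed
  moreover have "(LINT y|\<sigma>. deviation t y / c) \<le> 2 * (C / c) * (LINT y|\<sigma>. \<bar>B y\<bar>) * t powr \<beta>"
  proof -
    have "(LINT y|\<sigma>. measure \<sigma> (cap t y) * B y) \<le> (LINT y|\<sigma>. C * \<bar>B y\<bar>)"
    proof (rule Bochner_Integration.integral_mono)
      have i: "integrable \<sigma> (\<lambda>y. C * \<bar>B y\<bar>)"
        using B_integrable by simp
      then show "integrable \<sigma> (\<lambda>y. C * \<bar>B y\<bar>)" .
      have le: "\<bar>measure \<sigma> (cap t y) * B y\<bar> \<le> C * \<bar>B y\<bar>" if "norm y = 1" for y
        using cap(2) [OF that] by (simp add: abs_mult mult_right_mono)
      show "integrable \<sigma> (\<lambda>y. measure \<sigma> (cap t y) * B y)"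
      proof (rule Bochner_Integration.integrable_bound [OF i])
        show "AE y in \<sigma>. norm (measure \<sigma> (cap t y) * B y) \<le> norm (C * \<bar>B y\<bar>)"
          using AE_space
        proof eventually_elim
          case (elim y)
          then show ?case using order_trans [OF le [of y] abs_ge_self] by simp
        qed
      qed measurable
      show "measure \<sigma> (cap t y) * B y \<le> C * \<bar>B y\<bar>" if "y \<in> space \<sigma>" for y
        using that order_trans [OF abs_ge_self le [of y]] by simp
    qed
    from mult_left_mono [OF this, of "2 * t powr \<beta>"] integral_deviation(2) [OF t]
    have "(LINT y|\<sigma>. deviation t y) \<le> 2 * t powr \<beta> * (C * (LINT y|\<sigma>. \<bar>B y\<bar>))"
      by simp
    from divide_right_mono [OF this, of c] show ?thesis
      using c by (simp add: mult_ac)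
  qed
  ultimately show ?thesis by (rule hs_le_mono)
qed

text \<open>
  The radius is chosen with \<open>t ^ m = L / n\<close>.  The constant \<open>L\<close> is so large that the averaging operator has
  norm at most \<open>1/2\<close> away from \<open>r = n div 8\<close> dimensions, which leaves room for the rank \<open>4 r < n\<close> of the
  approximating operator; the factors \<open>64\<close> and \<open>144\<close> contain the \<open>16\<close> of \<open>n / 16 \<le> n div 8\<close>.
\<close>

lemma approx_number_bound:
  assumes dim: "2 \<le> DIM('a)" and S: "generated_by_kernel S Kh" and T: "\<And>f. T f = S (S f)"
  shows "(\<lambda>n. approx_number n T) \<in> O(\<lambda>n. real n powr (- 1 - \<beta> / real (DIM('a) - 1)))"
proof -
  define m where "m = DIM('a) - 1"
  have m: "0 < m" using dim by (simp add: m_def)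
  obtain c C :: real where c: "0 < c" and C: "0 < C" and cap:
    "\<And>t y :: 'a. 0 < t \<Longrightarrow> t \<le> 1 \<Longrightarrow> norm y = 1 \<Longrightarrow>
      c * t ^ m \<le> measure \<sigma> (cap t y) \<and> measure \<sigma> (cap t y) \<le> C * t ^ m"
    using cap_measure_bounds unfolding m_def by blast
  define L where "L = 64 * measure \<sigma> (sphere (0::'a) 1) / c + 1"
  \<comment> \<open>The summand \<open>1\<close> keeps \<open>A\<close> positive if \<open>B\<close> vanishes almost everywhere.\<close>
  define A where "A = 2 * (C / c) * (LINT y|\<sigma>. \<bar>B y\<bar>) + 1"
  have L: "0 < L" "64 * measure \<sigma> (sphere (0::'a) 1) \<le> c * L"
    using c by (simp_all add: L_def add_nonneg_pos distrib_left)
  have A: "0 < A"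
    using c C unfolding A_def by (intro add_nonneg_pos mult_nonneg_nonneg integral_nonneg) auto
  have S_clinear: "bounded_clinear S"
    using S Kh_L2 by (rule bounded_clinear_L2_kernel)
  have "T = (\<lambda>f. S (S f))" using T by blast
  then have T_clinear: "bounded_clinear T"
    by (simp add: bounded_clinear_compose [OF S_clinear S_clinear])
  have bound: "approx_number n T \<le> (144 * A * L powr (\<beta> / m)) * real n powr (- 1 - \<beta> / m)"
    if n: "16 \<le> n" "L \<le> real n" for n
  proof -
    define t where "t = (L / n) powr (1 / m)"
    define r where "r = n div 8"
    have t: "0 < t" "t \<le> 1"
      using n L by (auto simp: t_def intro!: powr_le1)
    have tm: "t ^ m = L / n"
      using L n m by (simp add: t_def powr_power)
    have tb: "t powr \<beta> = L powr (\<beta> / m) * real n powr (- \<beta> / m)"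
      using L n by (simp add: t_def powr_powr powr_divide powr_minus_divide)
    have r: "0 < r" "4 * r < n" "real n / 16 \<le> real r"
      using n unfolding r_def by linarith+
    have caps: "c * t ^ m \<le> measure \<sigma> (cap t y)" "measure \<sigma> (cap t y) \<le> C * t ^ m"
      if "norm y = 1" for y :: 'a
      using cap [OF t that] by auto
    have ct: "0 < c * t ^ m" using c t by simp
    have avg_L2: "case_prod (cap_kernel t) \<in> L2_fun (\<sigma> \<Otimes>\<^sub>M (\<sigma> :: 'a measure))"
      by (rule cap_kernel_L2 [OF ct caps(1)])
    note gen = generated_by_kernel_integral_operator [OF avg_L2]
    have avg: "hs_le (averaging t) (measure \<sigma> (sphere (0::'a) 1) / (c * t ^ m))"
      by (rule hs_le_mono [OF hs_le_L2_kernel [OF gen avg_L2] cap_kernel_L2(2) [OF ct caps(1)]])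
    have \<mu>: "4 * (measure \<sigma> (sphere (0::'a) 1) / (c * t ^ m)) \<le> real r"
    proof -
      have "4 * (measure \<sigma> (sphere (0::'a) 1) / (c * t ^ m)) =
          64 * measure \<sigma> (sphere (0::'a) 1) / (c * L) * (real n / 16)"
        using n by (simp add: tm mult_ac)
      also have "\<dots> \<le> 1 * (real n / 16)"
        using L c by (intro mult_right_mono) auto
      finally show ?thesis using r(3) by simp
    qed
    have "C * t ^ m / (c * t ^ m) = C / c" using t by simp
    then have "hs_le (\<lambda>f. S f - averaging t (S f)) (2 * (C / c) * (LINT y|\<sigma>. \<bar>B y\<bar>) * t powr \<beta>)"
      using hs_le_remainder [OF S t ct caps] by simp
    then have rem: "hs_le (\<lambda>f. S f - averaging t (S f)) (A * t powr \<beta>)"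
      by (rule hs_le_mono) (simp add: A_def distrib_right)
    have "approx_number n T \<le> 9 * (A * t powr \<beta>) / r"
      using A t
      by (intro approx_number_square_le [OF S_clinear bounded_clinear_L2_kernel [OF gen avg_L2]
            hs_le_L2_kernel [OF S Kh_L2] avg rem _ r(1) \<mu> r(2) T]) simp
    also have "\<dots> \<le> 9 * (A * t powr \<beta>) / (real n / 16)"
      using A t n r by (intro divide_left_mono) auto
    also have "\<dots> = (144 * A * L powr (\<beta> / m)) * (real n powr (- 1) * real n powr (- \<beta> / m))"
      using n by (simp add: tb powr_minus_divide mult_ac)
    also have "\<dots> = (144 * A * L powr (\<beta> / m)) * real n powr (- 1 - \<beta> / m)"
      unfolding powr_add [symmetric] by simp
    finally show ?thesis .
  qed
  have "eventually (\<lambda>n. 16 \<le> n \<and> L \<le> real n) sequentially"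
    using eventually_ge_at_top [of 16] eventually_ge_at_top [of "nat \<lceil>L\<rceil>"]
    by eventually_elim linarith
  then have "eventually (\<lambda>n. norm (approx_number n T) \<le>
      (144 * A * L powr (\<beta> / m)) * norm (real n powr (- 1 - \<beta> / m))) sequentially"
    by eventually_elim (use bound approx_number_nonneg [OF T_clinear] in simp)
  from bigoI [OF this] show ?thesis
    by (simp only: m_def)
qed

end

theorem theorem4p7:
  fixes m :: nat and \<beta> :: real
    and B :: "'a::euclidean_space \<Rightarrow> real"
    and K :: "'a \<Rightarrow> 'a \<Rightarrow> complex"
  assumes m: "m > 0" "DIM('a) = m + 1"
    and beta: "\<beta> \<in> {0<..2}"
    and B_Linf: "B \<in> borel_measurable sphere_measure" "\<exists>C. AE y in sphere_measure. \<bar>B y\<bar> \<le> C"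
    and B_nonneg: "\<forall>y\<in>sphere 0 1. B y \<ge> 0"
    and K_pos: "positive_integral_operator K"
    and K_holder: "averaged_holder B \<beta> K"
  shows "(\<lambda>n. approx_number n (integral_operator K)) \<in> O(\<lambda>n. real n powr (- \<beta> / real m)) \<and>
         (\<forall>S. is_sqrt_operator S (integral_operator K) \<and> (\<forall>f. has_continuous_representative (S f))
           \<longrightarrow> (\<lambda>n. approx_number n (integral_operator K)) \<in> O(\<lambda>n. real n powr (- 1 - \<beta> / real m)))"
proof -
  note K_props = K_pos [unfolded positive_integral_operator_def]
  have K: "case_prod K \<in> L2_fun (sphere_measure \<Otimes>\<^sub>M sphere_measure)"
    by (rule K_props [THEN conjunct1])
  obtain S Kh where Kh: "is_sqrt_operator S (integral_operator K) \<and> generated_by_kernel S Kh \<and>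
      (\<forall>x\<in>sphere 0 1. \<forall>y\<in>sphere 0 1. Kh x y = cnj (Kh y x)) \<and>
      (\<forall>y\<in>sphere 0 1. \<forall>w\<in>sphere 0 1.
         has_bochner_integral sphere_measure (\<lambda>x. Kh x y * Kh w x) (K w y))"
    by (rule exE [OF K_props [THEN conjunct2, THEN conjunct2]], erule exE) (rule that)
  note S = Kh [THEN conjunct1] Kh [THEN conjunct2, THEN conjunct1]
    and hermitian = Kh [THEN conjunct2, THEN conjunct2, THEN conjunct1]
    and factor = Kh [THEN conjunct2, THEN conjunct2, THEN conjunct2]
  obtain b where b: "AE y in sphere_measure. \<bar>B y\<bar> \<le> b"
    using B_Linf(2) by blast
  interpret averaged_holder_kernel K Kh B b \<beta>
  proof
    show "case_prod Kh \<in> borel_measurable (\<sigma> \<Otimes>\<^sub>M \<sigma>)"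
      using S(2) by (simp add: generated_by_kernel_def)
    show "Kh x y = cnj (Kh y x)" if "norm x = 1" "norm y = 1" for x y
      by (rule hermitian [THEN bspec, THEN bspec]) (simp_all add: that)
    show "has_bochner_integral \<sigma> (\<lambda>x. Kh x y * Kh w x) (K w y)" if "norm y = 1" "norm w = 1" for y w
      by (rule factor [THEN bspec, THEN bspec]) (simp_all add: that)
  qed (fact K B_Linf(1) b K_holder)+
  have strong: "(\<lambda>n. approx_number n (integral_operator K)) \<in> O(\<lambda>n. real n powr (- 1 - \<beta> / real m))"
    using approx_number_bound [OF _ S(2), of "integral_operator K"] S(1) m
    by (simp add: is_sqrt_operator_def)
  have "(\<lambda>n. real n powr (- 1 - \<beta> / real m)) \<in> O(\<lambda>n. real n powr (- \<beta> / real m))"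
  proof (rule bigoI [of _ 1])
    show "eventually (\<lambda>n. norm (real n powr (- 1 - \<beta> / real m)) \<le> 1 * norm (real n powr (- \<beta> / real m)))
        sequentially"
      using eventually_ge_at_top [of 1] by eventually_elim (simp add: powr_mono)
  qed
  with strong show ?thesis
    using landau_o.big_trans by blast
qed

end
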